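(* There exists a continuous map $f\colon G\to G$ of the Gehman dendrite $G$ to itself such that: (1) $f$ does not have DC3 pairs, i.e. no pair $(x,y)\in G\times G$ is a DC3 pair for $f$; (2) $f$ has an uncountable $\omega$-scrambled set.
   Context: A continuum is a nonempty connected compact metric space; a dendrite is a locally connected continuum containing no subset homeomorphic to the circle. The Gehman dendrite $G$ is the (topologically unique) dendrite whose set of end points is homeomorphic to the Cantor set and all of whose ramification points have order $3$. It is regarded as a compact metric space with a fixed metric $\rho$ inducing its topology. Let $(X,f)$ be a dynamical system: $X$ a compact metric space with metric $\rho$ and $f\colon X\to X$ continuous. For $x\in X$, $\omega_f(x)$ is the set of all limits of sequences $f^{n_k}(x)$ with $n_k\nearrow\infty$. DC3 pairs: for $x,y\in X$, $n\ge 1$ and $t\in(0,\operatorname{diam}X]$ let $F^{(n)}_{xy}(t)=\frac1n|\{0\le i<n:\rho(f^i(x),f^i(y))<t\}|$, $F_{xy}(t)=\liminf_{n\to\infty}F^{(n)}_{xy}(t)$, $F^*_{xy}(t)=\limsup_{n\to\infty}F^{(n)}_{xy}(t)$, extended by $F_{xy}(t)=F^*_{xy}(t)=0$ for $t\le0$ and $F_{xy}(t)=F^*_{xy}(t)=1$ for $t>\operatorname{diam}X$. The pair $(x,y)$ is a DC3 pair for $f$ if there are $a<b$ such that $F^*_{xy}(t)>F_{xy}(t)$ for every $t\in(a,b)$. $\omega$-scrambled set: a set $S\subseteq X$ is $\omega$-scrambled for $f$ if it contains at least two points and for any $x,y\in S$ with $x\ne y$: (i) $\omega_f(x)\setminus\omega_f(y)$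 is uncountable; (ii) $\omega_f(x)\cap\omega_f(y)$ is nonempty; (iii) $\omega_f(x)$ is not contained in the set of periodic points of $f$. *)

theory Defs
  imports "HOL-Analysis.Analysis"
begin

section \<open>Dendrites\<close>

text \<open>A continuum is a subset of a metric space carrying the restricted metric, so that all
  neighbourhoods and boundaries below are relative to the subset.\<close>

definition continuum :: "'a::metric_space set \<Rightarrow> bool" where
  "continuum X \<longleftrightarrow> X \<noteq> {} \<and> connected X \<and> compact X"

definition dendrite :: "'a::metric_space set \<Rightarrow> bool" where
  "dendrite X \<longleftrightarrow> continuum X \<and> locally connected X \<and>
     \<not> (\<exists>C\<subseteq>X. C homeomorphic sphere (0::complex) 1)"

text \<open>Order of a point in the sense of Menger and Urysohn: \<open>x\<close> has order at most \<open>n\<close> in \<open>X\<close> if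
  it has arbitrarily small open neighbourhoods whose boundary has at most \<open>n\<close> points.\<close>

definition order_at_most :: "'a::metric_space set \<Rightarrow> 'a \<Rightarrow> nat \<Rightarrow> bool" where
  "order_at_most X x n \<longleftrightarrow>
     (\<forall>U. openin (top_of_set X) U \<and> x \<in> U \<longrightarrow>
       (\<exists>V. openin (top_of_set X) V \<and> x \<in> V \<and> V \<subseteq> U \<and>
            finite (top_of_set X frontier_of V) \<and> card (top_of_set X frontier_of V) \<le> n))"

definition has_order :: "'a::metric_space set \<Rightarrow> 'a \<Rightarrow> nat \<Rightarrow> bool" where
  "has_order X x n \<longleftrightarrow> order_at_most X x n \<and> (\<forall>m<n. \<not> order_at_most X x m)"

definition end_points :: "'a::metric_space set \<Rightarrow> 'a set" where
  "end_points X = {x \<in> X. has_order X x 1}"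

text \<open>Ramification points are the points of order at least 3, infinite orders included.\<close>

definition ramification_points :: "'a::metric_space set \<Rightarrow> 'a set" where
  "ramification_points X = {x \<in> X. \<not> order_at_most X x 2}"

definition cantor_set :: "real set" where
  "cantor_set = {\<Sum>n. a n / 3 ^ Suc n | a :: nat \<Rightarrow> real. \<forall>n. a n \<in> {0, 2}}"

definition gehman_dendrite :: "'a::metric_space set \<Rightarrow> bool" where
  "gehman_dendrite G \<longleftrightarrow> dendrite G \<and> end_points G homeomorphic cantor_set \<and>
     (\<forall>x \<in> ramification_points G. has_order G x 3)"


section \<open>Dynamical systems\<close>

definition omega_limit :: "('a::metric_space \<Rightarrow> 'a) \<Rightarrow> 'a \<Rightarrow> 'a set" where
  "omega_limit f x =
     {y. \<exists>k :: nat \<Rightarrow> nat. strict_mono k \<and> (\<lambda>i. (f ^^ k i) x) \<longlonglongrightarrow> y}"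

definition periodic_points :: "'a set \<Rightarrow> ('a \<Rightarrow> 'a) \<Rightarrow> 'a set" where
  "periodic_points X f = {x \<in> X. \<exists>n>0. (f ^^ n) x = x}"

definition prox_freq :: "('a::metric_space \<Rightarrow> 'a) \<Rightarrow> 'a \<Rightarrow> 'a \<Rightarrow> nat \<Rightarrow> real \<Rightarrow> real" where
  "prox_freq f x y n t =
     real (card {i. i < n \<and> dist ((f ^^ i) x) ((f ^^ i) y) < t}) / real n"

text \<open>The lower and upper distribution functions take values in \<open>[0,1]\<close>; they are typed as
  extended reals because \<open>liminf\<close> and \<open>limsup\<close> need a complete lattice.\<close>

definition lower_dist_fun ::
  "'a::metric_space set \<Rightarrow> ('a \<Rightarrow> 'a) \<Rightarrow> 'a \<Rightarrow> 'a \<Rightarrow> real \<Rightarrow> ereal" where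
  "lower_dist_fun X f x y t =
     (if t \<le> 0 then 0 else if t > diameter X then 1
      else liminf (\<lambda>n. ereal (prox_freq f x y n t)))"

definition upper_dist_fun ::
  "'a::metric_space set \<Rightarrow> ('a \<Rightarrow> 'a) \<Rightarrow> 'a \<Rightarrow> 'a \<Rightarrow> real \<Rightarrow> ereal" where
  "upper_dist_fun X f x y t =
     (if t \<le> 0 then 0 else if t > diameter X then 1
      else limsup (\<lambda>n. ereal (prox_freq f x y n t)))"

definition DC3_pair :: "'a::metric_space set \<Rightarrow> ('a \<Rightarrow> 'a) \<Rightarrow> 'a \<Rightarrow> 'a \<Rightarrow> bool" where
  "DC3_pair X f x y \<longleftrightarrow> x \<in> X \<and> y \<in> X \<and>
     (\<exists>a b. a < b \<and> (\<forall>t\<in>{a<..<b}. upper_dist_fun X f x y t > lower_dist_fun X f x y t))"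

definition omega_scrambled :: "'a::metric_space set \<Rightarrow> ('a \<Rightarrow> 'a) \<Rightarrow> 'a set \<Rightarrow> bool" where
  "omega_scrambled X f S \<longleftrightarrow> S \<subseteq> X \<and> (\<exists>x\<in>S. \<exists>y\<in>S. x \<noteq> y) \<and>
     (\<forall>x\<in>S. \<forall>y\<in>S. x \<noteq> y \<longrightarrow>
        uncountable (omega_limit f x - omega_limit f y) \<and>
        omega_limit f x \<inter> omega_limit f y \<noteq> {} \<and>
        \<not> omega_limit f x \<subseteq> periodic_points X f)"

end

theory Submission
  imports Defs "HOL-Real_Asymp.Real_Asymp"
begin

text \<open>Let \<open>L\<close> be the language of a one-sided subshift over two letters in which the ones have density
  zero, uniformly.  Since every end point of \<open>G\<close> has arbitrarily small neighbourhoods bounded by a single cut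
  point, and no end point is isolated among the end points, there is a Cantor scheme of open sets
  \<open>V w\<close> with one-point boundary \<open>c w\<close>, indexed by binary words.  The map \<open>f\<close> sends the
  part of \<open>V w\<close>, \<open>w \<in> L\<close>, outside the next level to a path from \<open>c (butlast (tl w))\<close> to
  \<open>c (tl w)\<close>.  It extends the shift on the limit points of the scheme, and every other point
  reaches the fixed point \<open>c []\<close> in finitely many steps.  Hence every orbit is attracted, along a set of
  times of density one, to one of two fixed points, which excludes DC3 pairs.

  The scrambled set comes from the ruler sequences, where the gap after the \<open>j\<close>-th one has length
  \<open>4 ^ v + \<alpha> v\<close> with \<open>v\<close> the 2-adic valuation of \<open>j\<close>: their orbit closures contain a
  2-adic family of points in which all these gaps occur, so that each of them determines the parameter
  \<open>\<alpha>\<close>.\<close>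

section \<open>Locally connected continua are path connected\<close>

text \<open>A one-point boundary is what allows interpolation: collapsing the outside of
  \<open>V w\<close> and the inside of both successors to their cut points retracts \<open>G\<close>
  onto the piece between two levels, so any path of \<open>G\<close> can be pushed into that piece.
  Paths exist because a locally connected continuum is path connected. An application of
  \<open>f\<close> may cost two levels, one for the shift and one because the path starts at the
  parent cut point; the images still shrink, so the stages of the construction converge uniformly.
  Sparsity of ones has to hold in every window of the language, since points in the closure of an
  orbit must be attracted as well. Gaps of length \<open>4 ^ v\<close> achieve this:
  \<open>2 ^ m\<close> consecutive gaps include one of length at least \<open>4 ^ m\<close>, so a
  window holds a number of ones of the order of the square root of its length. The factor 4 between
  successive gaps also leaves room for the extra bit, so a single gap length reveals both
  \<open>v\<close> and \<open>\<alpha> v\<close>.\<close>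

lemma connected_imp_chain:
  fixes C :: "'a::metric_space set"
  assumes "connected C" "x \<in> C" "y \<in> C" "d > 0"
  obtains m p where "p 0 = x" "p m = y" "\<And>i. i \<le> m \<Longrightarrow> p i \<in> C"
    "\<And>i. i < m \<Longrightarrow> dist (p i) (p (Suc i)) < d"
proof -
  define r where "r = {(u, v). u \<in> C \<and> v \<in> C \<and> dist u v < d}"
  have symr: "sym r"
    by (auto simp: r_def sym_def dist_commute)
  \<comment> \<open>The classes of the generated equivalence relation are open, so a connected set
    has only one.\<close>
  have "(x, y) \<in> r\<^sup>*"
  proof (rule connected_equivalence_relation[OF assms(1-3)])
    show "(b, a) \<in> r\<^sup>*" if "(a, b) \<in> r\<^sup>*" for a b
      using that sym_rtrancl[OF symr] by (auto dest: symD)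
    show "(a, e) \<in> r\<^sup>*" if "(a, b) \<in> r\<^sup>*" "(b, e) \<in> r\<^sup>*" for a b e
      using that by auto
    show "\<exists>T. openin (top_of_set C) T \<and> a \<in> T \<and> (\<forall>x\<in>T. (a, x) \<in> r\<^sup>*)" if "a \<in> C" for a
      using that assms(4) by (intro exI[of _ "C \<inter> ball a d"]) (auto simp: r_def openin_open_Int)
  qed
  then obtain m where "(x, y) \<in> r ^^ m"
    using rtrancl_imp_relpow by blast
  then obtain p where p: "p 0 = x" "p m = y" "\<And>i. i < m \<Longrightarrow> (p i, p (Suc i)) \<in> r"
    by (auto simp: relpow_fun_conv)
  have "p i \<in> C" if "i \<le> m" for i
    using p(3)[of i] p(2) that assms(3) by (cases "i < m") (auto simp: r_def)
  with p show thesis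
    by (intro that[of p m]) (auto simp: r_def)
qed

text \<open>\<open>d\<close> is a Lebesgue number of the cover by open sets whose trace on
  \<open>G\<close> lies in a connected subset of \<open>G\<close> with all distances below
  \<open>e\<close>.\<close>

lemma uniformly_locally_connected:
  fixes G :: "'a::metric_space set"
  assumes "compact G" "locally connected G" "e > 0"
  obtains d where "d > 0"
    "\<And>x y. \<lbrakk>x \<in> G; y \<in> G; dist x y < d\<rbrakk> \<Longrightarrow>
      \<exists>C. connected C \<and> x \<in> C \<and> y \<in> C \<and> C \<subseteq> G \<inter> ball x e"
proof -
  define \<C> where "\<C> = {T. open T \<and> (\<exists>C. connected C \<and> G \<inter> T \<subseteq> C \<and> C \<subseteq> G \<and> (\<forall>u\<in>C. \<forall>v\<in>C. dist u v < e))}"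
  have "G \<subseteq> \<Union>\<C>"
  proof
    fix x assume x: "x \<in> G"
    have "openin (top_of_set G) (G \<inter> ball x (e/2))"
      by (auto simp: openin_open_Int)
    moreover have "x \<in> G \<inter> ball x (e/2)"
      using x assms(3) by simp
    ultimately obtain U C where UC: "openin (top_of_set G) U" "connected C" "x \<in> U" "U \<subseteq> C" "C \<subseteq> G \<inter> ball x (e/2)"
      using assms(2) unfolding locally_def by metis
    obtain T where T: "open T" "U = G \<inter> T"
      using UC(1) by (auto simp: openin_open)
    have "dist u v < e" if "u \<in> C" "v \<in> C" for u v
    proof -
      have "dist x u < e/2" "dist x v < e/2"
        using that UC(5) by auto
      then show ?thesis
        using dist_triangle_half_r by blast
    qed
    then have "T \<in> \<C>"
      using T UC unfolding \<C>_def by blast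
    then show "x \<in> \<Union>\<C>"
      using T UC(3) by blast
  qed
  then obtain d where d: "d > 0" "\<And>x. x \<in> G \<Longrightarrow> \<exists>T\<in>\<C>. ball x d \<subseteq> T"
    using Heine_Borel_lemma[OF assms(1)] unfolding \<C>_def by (metis (no_types, lifting) mem_Collect_eq)
  show thesis
  proof (rule that[OF d(1)])
    fix x y assume xy: "x \<in> G" "y \<in> G" "dist x y < d"
    obtain T where T: "T \<in> \<C>" "ball x d \<subseteq> T"
      using d(2) xy by blast
    then obtain C where C: "connected C" "G \<inter> T \<subseteq> C" "C \<subseteq> G" "\<forall>u\<in>C. \<forall>v\<in>C. dist u v < e"
      unfolding \<C>_def by blast
    have "x \<in> T" "y \<in> T"
      using xy T(2) d(1) by (auto simp: subset_iff)
    with C xy have "x \<in> C" "y \<in> C" "C \<subseteq> G \<inter> ball x e"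
      by auto
    with C(1) show "\<exists>C. connected C \<and> x \<in> C \<and> y \<in> C \<and> C \<subseteq> G \<inter> ball x e"
      by blast
  qed
qed

lemma geometric_step_dist:
  fixes h :: "nat \<Rightarrow> 'a::metric_space"
  assumes "\<And>n. dist (h n) (h (Suc n)) \<le> (1/2)^n"
  shows "dist (h N) (h (N + k)) \<le> 2 * (1/2)^N"
proof -
  \<comment> \<open>The factor \<open>1 - (1/2)^k\<close> makes this the exact partial geometric
    sum, which the induction needs.\<close>
  have "dist (h N) (h (N + k)) \<le> 2 * (1/2)^N * (1 - (1/2)^k)"
  proof (induction k)
    case (Suc k)
    have "dist (h N) (h (N + Suc k)) \<le> dist (h N) (h (N + k)) + dist (h (N + k)) (h (Suc (N + k)))"
      by (simp add: dist_triangle)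
    with Suc assms[of "N + k"] show ?case
      by (simp add: algebra_simps power_add)
  qed simp
  also have "\<dots> \<le> 2 * (1/2::real)^N"
    by (simp add: mult_left_le)
  finally show ?thesis .
qed

lemma geometric_step_Cauchy:
  fixes h :: "nat \<Rightarrow> 'a::metric_space"
  assumes "\<And>n. dist (h n) (h (Suc n)) \<le> (1/2)^n"
  shows "Cauchy h"
proof (rule metric_CauchyI)
  fix e :: real assume "e > 0"
  then obtain N where N: "(1/2::real)^N < e/4"
    using real_arch_pow_inv[of "e/4" "1/2"] by auto
  have "dist (h m) (h n) < e" if "m \<ge> N" "n \<ge> N" for m n
  proof -
    have "dist (h N) (h m) \<le> 2 * (1/2)^N" "dist (h N) (h n) \<le> 2 * (1/2)^N"
      using geometric_step_dist[of h N "m - N"] geometric_step_dist[of h N "n - N"] assms that by auto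
    with N show ?thesis
      using dist_triangle3[of "h m" "h n" "h N"] by linarith
  qed
  then show "\<exists>M. \<forall>m\<ge>M. \<forall>n\<ge>M. dist (h m) (h n) < e"
    by blast
qed

text \<open>Each link is replaced by a finer chain inside a small connected set. All links receive
  the same number \<open>M\<close> of new links, so that proportional indices of successive chains
  stay together; this is what makes the chains converge as functions of a real parameter.\<close>

lemma chain_refinement:
  fixes G :: "'a::metric_space set"
  assumes p: "\<And>i. i \<le> N \<Longrightarrow> p i \<in> G" "\<And>i. i < N \<Longrightarrow> dist (p i) (p (Suc i)) < d"
    and conn: "\<And>x y. \<lbrakk>x \<in> G; y \<in> G; dist x y < d\<rbrakk> \<Longrightarrow>
      \<exists>C. connected C \<and> x \<in> C \<and> y \<in> C \<and> C \<subseteq> G \<inter> ball x e"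
    and "d' > 0"
  obtains M q where "M > 0" "q 0 = p 0" "q (N * M) = p N" "\<And>i. i \<le> N * M \<Longrightarrow> q i \<in> G"
    "\<And>i. i < N * M \<Longrightarrow> dist (q i) (q (Suc i)) < d'"
    "\<And>i j. \<lbrakk>i < N; j < M\<rbrakk> \<Longrightarrow> dist (p i) (q (i * M + j)) < e"
proof -
  have "\<exists>m r. i < N \<longrightarrow> r 0 = p i \<and> r m = p (Suc i) \<and> (\<forall>j\<le>m. r j \<in> G \<inter> ball (p i) e) \<and>
      (\<forall>j<m. dist (r j) (r (Suc j)) < d')" for i
  proof (cases "i < N")
    case iN: True
    obtain C where C: "connected C" "p i \<in> C" "p (Suc i) \<in> C" "C \<subseteq> G \<inter> ball (p i) e"
      using conn[OF p(1) p(1) p(2), of i] iN by auto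
    obtain m r where "r 0 = p i" "r m = p (Suc i)" "\<And>j. j \<le> m \<Longrightarrow> r j \<in> C"
        "\<And>j. j < m \<Longrightarrow> dist (r j) (r (Suc j)) < d'"
      using connected_imp_chain[OF C(1-3) \<open>d' > 0\<close>] by metis
    with C(4) show ?thesis
      by (intro exI[of _ m] exI[of _ r] conjI) blast+
  qed simp
  then obtain m r where "\<And>i. i < N \<longrightarrow> r i 0 = p i \<and> r i (m i) = p (Suc i) \<and>
      (\<forall>j\<le>m i. r i j \<in> G \<inter> ball (p i) e) \<and> (\<forall>j<m i. dist (r i j) (r i (Suc j)) < d')"
    by metis
  then have r: "\<And>i. i < N \<Longrightarrow> r i 0 = p i" "\<And>i. i < N \<Longrightarrow> r i (m i) = p (Suc i)"
     "\<And>i j. \<lbrakk>i < N; j \<le> m i\<rbrakk> \<Longrightarrow> r i j \<in> G \<inter> ball (p i) e"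
     "\<And>i j. \<lbrakk>i < N; j < m i\<rbrakk> \<Longrightarrow> dist (r i j) (r i (Suc j)) < d'"
    by auto
  define M where "M = Suc (\<Sum>i<N. m i)"
  have mM: "m i < M" if "i < N" for i
    using that member_le_sum[of i "{..<N}" m] by (simp add: M_def less_Suc_eq_le)
  define q where "q = (\<lambda>k. if k < N * M then r (k div M) (min (k mod M) (m (k div M))) else p N)"
  have M0: "M > 0"
    by (simp add: M_def)
  have q_eq: "q (i * M + j) = r i (min j (m i))" if "i < N" "j < M" for i j
  proof -
    have "i * M + j < N * M"
      using that mult_le_mono1[of "Suc i" N M] by simp
    then show ?thesis
      using that by (simp add: q_def)
  qed
  show thesis
  proof (rule that[of M q])
    show "q 0 = p 0"
      using q_eq[of 0 0] r(1)[of 0] M0 by (cases "N = 0") (auto simp: q_def)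
    show "q (N * M) = p N"
      by (simp add: q_def)
    show "q k \<in> G" if "k \<le> N * M" for k
    proof (cases "k < N * M")
      case True
      then have "k div M < N"
        by (simp add: less_mult_imp_div_less)
      then show ?thesis
        using True r(3)[of "k div M"] by (simp add: q_def)
    qed (use p(1)[of N] in \<open>simp add: q_def\<close>)
    show "dist (p i) (q (i * M + j)) < e" if "i < N" "j < M" for i j
      using r(3)[of i "min j (m i)"] q_eq[OF that] that(1) by auto
    show "dist (q k) (q (Suc k)) < d'" if k: "k < N * M" for k
    proof -
      define i j where "i = k div M" and "j = k mod M"
      have ij: "k = i * M + j" "j < M" "i < N"
        using M0 k by (auto simp: i_def j_def less_mult_imp_div_less)
      show ?thesis
      proof (cases "Suc j < M")
        case True
        have "q (Suc k) = r i (min (Suc j) (m i))"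
          using q_eq[of i "Suc j"] True ij by simp
        moreover have "q k = r i (min j (m i))"
          using q_eq ij by simp
        ultimately show ?thesis
          using r(4)[of i j] ij(3) \<open>d' > 0\<close> by (cases "j < m i") (auto simp: min_def)
      next
        case False
        then have j: "Suc j = M"
          using ij by simp
        then have qk: "q k = p (Suc i)"
          using q_eq[of i j] ij mM[of i] r(2)[of i] by (simp add: min_absorb2)
        have k': "Suc k = Suc i * M"
          using ij j by simp
        have "q (Suc k) = p (Suc i)"
        proof (cases "Suc i = N")
          case True
          then show ?thesis
            using k' by (simp add: q_def)
        next
          case False
          then show ?thesis
            unfolding k' using q_eq[of "Suc i" 0] r(1)[of "Suc i"] ij M0 by simp
        qed
        with qk \<open>d' > 0\<close> show ?thesis
          by simp
      qed
    qed
  qed (rule M0)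
qed

text \<open>The path is the uniform limit of step functions through successively refined chains.\<close>

theorem locally_connected_continuum_imp_path_connected:
  fixes G :: "'a::metric_space set"
  assumes G: "compact G" "connected G" "locally connected G"
  shows "path_connected G"
  unfolding path_connected_def
proof (intro ballI)
  fix a b assume ab: "a \<in> G" "b \<in> G"
  have "\<exists>d>0. d \<le> (1/2)^n \<and> (\<forall>x y. x \<in> G \<and> y \<in> G \<and> dist x y < d \<longrightarrow>
      (\<exists>C. connected C \<and> x \<in> C \<and> y \<in> C \<and> C \<subseteq> G \<inter> ball x ((1/2)^n)))" for n :: nat
  proof -
    obtain d where "d > 0" "\<And>x y. \<lbrakk>x \<in> G; y \<in> G; dist x y < d\<rbrakk> \<Longrightarrow>
      \<exists>C. connected C \<and> x \<in> C \<and> y \<in> C \<and> C \<subseteq> G \<inter> ball x ((1/2)^n)"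
      by (rule uniformly_locally_connected[OF G(1,3), of "(1/2)^n"]) auto
    then show ?thesis
      by (intro exI[of _ "min d ((1/2)^n)"]) auto
  qed
  then obtain d :: "nat \<Rightarrow> real" where d: "\<And>n. d n > 0" "\<And>n. d n \<le> (1/2)^n"
    "\<And>n x y. \<lbrakk>x \<in> G; y \<in> G; dist x y < d n\<rbrakk> \<Longrightarrow>
      \<exists>C. connected C \<and> x \<in> C \<and> y \<in> C \<and> C \<subseteq> G \<inter> ball x ((1/2)^n)"
    by metis
  define Q :: "nat \<Rightarrow> nat \<times> (nat \<Rightarrow> 'a) \<Rightarrow> bool" where
    "Q n s \<longleftrightarrow> snd s 0 = a \<and> snd s (fst s) = b \<and> (\<forall>i\<le>fst s. snd s i \<in> G) \<and>
      (\<forall>i<fst s. dist (snd s i) (snd s (Suc i)) < d n) \<and> fst s > 0" for n s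
  define T :: "nat \<Rightarrow> nat \<times> (nat \<Rightarrow> 'a) \<Rightarrow> nat \<times> (nat \<Rightarrow> 'a) \<Rightarrow> bool" where
    "T n s s' \<longleftrightarrow> (\<exists>M>0. fst s' = fst s * M \<and>
       (\<forall>i<fst s. \<forall>j<M. dist (snd s i) (snd s' (i * M + j)) < (1/2)^n))" for n s s'
  have "\<exists>s. \<forall>n. Q n (s n) \<and> T n (s n) (s (Suc n))"
  proof (rule dependent_nat_choice)
    obtain m p where p: "p 0 = a" "p m = b" "\<And>i. i \<le> m \<Longrightarrow> p i \<in> G"
        "\<And>i. i < m \<Longrightarrow> dist (p i) (p (Suc i)) < d 0"
      using connected_imp_chain[OF G(2) ab d(1)[of 0]] by metis
    \<comment> \<open>The chain may have length 0 when \<open>a = b\<close>; repeating its last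
      point gives the positive length that \<open>Q\<close> demands.\<close>
    define p' where "p' = (\<lambda>i. p (min i m))"
    have "Q 0 (Suc m, p')"
      unfolding Q_def fst_conv snd_conv p'_def using p d(1)[of 0]
      by (auto simp: min_def not_le less_Suc_eq Suc_le_eq)
    then show "\<exists>s. Q 0 s" ..
    show "\<exists>s'. Q (Suc n) s' \<and> T n s s'" if Q: "Q n s" for s n
    proof -
      obtain N p where s: "s = (N, p)"
        by fastforce
      have p: "\<And>i. i \<le> N \<Longrightarrow> p i \<in> G" "\<And>i. i < N \<Longrightarrow> dist (p i) (p (Suc i)) < d n"
        using Q by (auto simp: Q_def s)
      show ?thesis
      proof (rule chain_refinement[of N p G "d n" "(1/2)^n" "d (Suc n)"])
        show "\<exists>C. connected C \<and> x \<in> C \<and> y \<in> C \<and> C \<subseteq> G \<inter> ball x ((1/2)^n)"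
          if "x \<in> G" "y \<in> G" "dist x y < d n" for x y
          using that by (rule d(3))
        show "\<exists>s'. Q (Suc n) s' \<and> T n s s'"
          if "M > 0" "q 0 = p 0" "q (N * M) = p N" "\<And>i. i \<le> N * M \<Longrightarrow> q i \<in> G"
            "\<And>i. i < N * M \<Longrightarrow> dist (q i) (q (Suc i)) < d (Suc n)"
            "\<And>i j. \<lbrakk>i < N; j < M\<rbrakk> \<Longrightarrow> dist (p i) (q (i * M + j)) < (1/2)^n" for M q
          using Q that by (intro exI[of _ "(N * M, q)"]) (auto simp: Q_def T_def s)
      qed (use p d(1) in auto)
    qed
  qed
  then obtain s where s: "\<And>n. Q n (s n)" "\<And>n. T n (s n) (s (Suc n))"
    by blast
  define N where "N = (\<lambda>n. fst (s n))"
  define p where "p = (\<lambda>n. snd (s n))"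
  define h where "h = (\<lambda>t n. p n (nat \<lfloor>t * real (N n)\<rfloor>))"
  have N0: "N n > 0" for n
    using s(1)[of n] by (simp add: Q_def N_def)
  have p: "p n 0 = a" "p n (N n) = b" for n
    using s(1)[of n] by (auto simp: Q_def N_def p_def)
  have pG: "p n i \<in> G" if "i \<le> N n" for n i
    using s(1)[of n] that by (auto simp: Q_def N_def p_def)
  have pd: "dist (p n i) (p n (Suc i)) < (1/2)^n" if "i < N n" for n i
    using s(1)[of n] that d(2)[of n] by (fastforce simp: Q_def N_def p_def)
  have floor_le: "nat \<lfloor>t * real (N n)\<rfloor> \<le> N n" if "t \<in> {0..1}" for t n
  proof -
    have "t * real (N n) \<le> real (N n)"
      using that by (simp add: mult_left_le_one_le)
    then show ?thesis
      by linarith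
  qed
  have hG: "h t n \<in> G" if "t \<in> {0..1}" for t n
    unfolding h_def using pG floor_le that by blast
  have step: "dist (h t n) (h t (Suc n)) \<le> (1/2)^n" if t: "t \<in> {0..1}" for t n
  \<comment> \<open>At \<open>t = 1\<close> the index is \<open>N n\<close>, which belongs to no
    block; there every step function takes the value \<open>b\<close>.\<close>
  proof (cases "t = 1")
    case False
    obtain M where M: "M > 0" "N (Suc n) = N n * M"
      "\<And>i j. \<lbrakk>i < N n; j < M\<rbrakk> \<Longrightarrow> dist (p n i) (p (Suc n) (i * M + j)) < (1/2)^n"
      using s(2)[of n] by (auto simp: T_def N_def p_def)
    define i where "i = nat \<lfloor>t * real (N n)\<rfloor>"
    define k where "k = nat \<lfloor>t * real (N (Suc n))\<rfloor>"
    have tN: "0 \<le> t * real (N n)" "t * real (N n) < real (N n)"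
      using False t N0[of n] by auto
    have i: "real i \<le> t * real (N n)" "t * real (N n) < real i + 1" "i < N n"
      using tN unfolding i_def by linarith+
    have "real i * real M \<le> t * real (N n) * real M" "t * real (N n) * real M < (real i + 1) * real M"
      using i M(1) by (simp_all add: mult_right_mono)
    then have "real (i * M) \<le> t * real (N (Suc n))" "t * real (N (Suc n)) < real (i * M + M)"
      using M(2) by (simp_all add: algebra_simps)
    then have "i * M \<le> k" "k < i * M + M"
      unfolding k_def by linarith+
    then obtain j where j: "k = i * M + j" "j < M"
      using le_Suc_ex by fastforce
    show ?thesis
      using M(3)[OF i(3) j(2)] unfolding h_def i_def[symmetric] k_def[symmetric] j by simp
  qed (simp add: h_def p)
  have "\<exists>l\<in>G. h t \<longlonglongrightarrow> l" if "t \<in> {0..1}" for t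
    using compact_imp_complete[OF G(1)] geometric_step_Cauchy[of "h t"] step[OF that] hG[OF that]
    unfolding complete_def by blast
  then obtain g where g: "\<And>t. t \<in> {0..1} \<Longrightarrow> g t \<in> G" "\<And>t. t \<in> {0..1} \<Longrightarrow> h t \<longlonglongrightarrow> g t"
    by metis
  have hg: "dist (h t n) (g t) \<le> 2 * (1/2)^n" if "t \<in> {0..1}" for t n
  proof (rule LIMSEQ_le_const2)
    show "(\<lambda>k. dist (h t n) (h t (k + n))) \<longlonglongrightarrow> dist (h t n) (g t)"
      using LIMSEQ_ignore_initial_segment[OF g(2)[OF that], of n] by (intro tendsto_intros)
    show "\<exists>K. \<forall>k\<ge>K. dist (h t n) (h t (k + n)) \<le> 2 * (1/2)^n"
      using geometric_step_dist[of "h t" n, OF step[OF that]] by (simp add: add.commute)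
  qed
  have "continuous_on {0..1} g"
    unfolding continuous_on_iff
  proof (intro ballI allI impI)
    fix t e :: real assume t: "t \<in> {0..1}" and "e > 0"
    \<comment> \<open>The fifth pays for two uniform errors of \<open>2 * (1/2)^n\<close> and one
      chain link of \<open>(1/2)^n\<close>.\<close>
    then obtain n where n: "(1/2::real)^n < e/5"
      using real_arch_pow_inv[of "e/5" "1/2"] by auto
    show "\<exists>r>0. \<forall>t'\<in>{0..1}. dist t' t < r \<longrightarrow> dist (g t') (g t) < e"
    proof (intro exI[of _ "1 / real (N n)"] conjI ballI impI)
      fix t' assume t': "t' \<in> {0..1}" "dist t' t < 1 / real (N n)"
      \<comment> \<open>Parameters closer than \<open>1 / N n\<close> have equal or consecutive
        chain indices.\<close>
      have hh: "dist (h u n) (h v n) \<le> (1/2)^n"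
        if "u \<le> v" "u \<in> {0..1}" "v \<in> {0..1}" "v - u < 1 / real (N n)" for u v
      proof -
        have "(v - u) * real (N n) < 1"
          using that N0[of n] by (simp add: field_simps)
        then have "v * real (N n) < u * real (N n) + 1"
          by (simp add: algebra_simps)
        moreover have "u * real (N n) \<le> v * real (N n)" "u * real (N n) \<ge> 0"
          using that by (auto simp: mult_right_mono)
        ultimately have "nat \<lfloor>v * real (N n)\<rfloor> = nat \<lfloor>u * real (N n)\<rfloor> \<or>
            nat \<lfloor>v * real (N n)\<rfloor> = Suc (nat \<lfloor>u * real (N n)\<rfloor>)"
          by linarith
        then show ?thesis
        proof
          assume *: "nat \<lfloor>v * real (N n)\<rfloor> = Suc (nat \<lfloor>u * real (N n)\<rfloor>)"
          then have "nat \<lfloor>u * real (N n)\<rfloor> < N n"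
            using floor_le[of v n] that by simp
          then show ?thesis
            using pd[of "nat \<lfloor>u * real (N n)\<rfloor>" n] * by (simp add: h_def)
        qed (simp add: h_def)
      qed
      have "dist (h t' n) (h t n) \<le> (1/2)^n"
        using hh[of t t'] hh[of t' t] t t' by (cases "t \<le> t'") (auto simp: dist_real_def dist_commute)
      moreover have "dist (g t') (g t) \<le> dist (g t') (h t' n) + dist (h t' n) (h t n) + dist (h t n) (g t)"
        using dist_triangle[of "g t'" "g t" "h t' n"] dist_triangle[of "h t' n" "g t" "h t n"] by linarith
      ultimately show "dist (g t') (g t) < e"
        using hg[of t n] hg[of t' n] t t' n by (simp add: dist_commute)
    qed (use N0 in simp)
  qed
  moreover have "g 0 = a" "g 1 = b"
    using g(2)[of 0] g(2)[of 1] LIMSEQ_unique[of "\<lambda>_. a"] LIMSEQ_unique[of "\<lambda>_. b"] by (auto simp: h_def p)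
  ultimately show "\<exists>g. path g \<and> path_image g \<subseteq> G \<and> pathstart g = a \<and> pathfinish g = b"
    using g(1) by (intro exI[of _ g]) (auto simp: path_def path_image_def pathstart_def pathfinish_def)
qed

section \<open>Extending a subshift along a Cantor scheme of cut points\<close>

definition pref :: "(nat \<Rightarrow> bool) \<Rightarrow> nat \<Rightarrow> bool list" where
  "pref s n = map s [0..<n]"

lemma length_pref [simp]: "length (pref s n) = n"
  by (simp add: pref_def)

lemma pref_0 [simp]: "pref s 0 = []"
  by (simp add: pref_def)

lemma pref_Suc: "pref s (Suc n) = pref s n @ [s n]"
  by (simp add: pref_def)

lemma tl_pref: "tl (pref s (Suc n)) = pref (s \<circ> Suc) n"
  by (simp add: pref_def upt_rec[of 0] map_Suc_upt[symmetric] del: upt_Suc)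

lemma butlast_pref: "butlast (pref s (Suc n)) = pref s n"
  by (simp add: pref_Suc)

lemma pref_eq_iff: "pref s n = pref s' n \<longleftrightarrow> (\<forall>i<n. s i = s' i)"
  by (auto simp: pref_def)

text \<open>Testing prefixes suffices: the languages used are closed under \<open>tl\<close>, so
  every factor of such a sequence belongs to the language.\<close>

definition shift_space :: "bool list set \<Rightarrow> (nat \<Rightarrow> bool) set" where
  "shift_space L = {s. \<forall>n. pref s n \<in> L}"

text \<open>The sets \<open>insert q A\<close> and \<open>G - A\<close> are closed and meet at most
  in \<open>q\<close>, where the two pieces of either map agree.\<close>

lemma continuous_on_collapse:
  fixes G :: "'a::metric_space set"
  assumes "closed G" "openin (top_of_set G) A" "closed (insert q A)" "q \<in> G"
  shows "continuous_on G (\<lambda>y. if y \<in> A then q else y)" "continuous_on G (\<lambda>y. if y \<in> A then y else q)"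
proof -
  have cl: "closed (G - A)"
    using assms(1,2) by (metis closedin_closed_trans closedin_diff closedin_self topspace_euclidean_subtopology)
  have G: "G = insert q A \<union> (G - A)"
    using assms(2,4) openin_imp_subset by blast
  have "continuous_on (insert q A \<union> (G - A)) (\<lambda>y. if y \<in> A then q else y)"
    by (rule continuous_on_cases[OF assms(3) cl]) auto
  then show "continuous_on G (\<lambda>y. if y \<in> A then q else y)"
    using G by simp
  have "continuous_on (insert q A \<union> (G - A)) (\<lambda>y. if y \<in> A then y else q)"
    by (rule continuous_on_cases[OF assms(3) cl]) auto
  then show "continuous_on G (\<lambda>y. if y \<in> A then y else q)"
    using G by simp
qed

text \<open>\<open>V []\<close> is the whole space and has no boundary, so the conditions on
  \<open>c w\<close> as a cut point start at nonempty words; \<open>c []\<close> is a base point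
  outside both sets of the first level. Each closed piece lies in the open set one level up, so
  nested open and nested closed pieces have the same intersection.\<close>

locale cut_scheme =
  fixes G :: "'a::metric_space set" and V :: "bool list \<Rightarrow> 'a set" and c :: "bool list \<Rightarrow> 'a"
  assumes compact_G: "compact G" and path_connected_G: "path_connected G"
    and V_Nil: "V [] = G"
    and openin_V: "openin (top_of_set G) (V w)"
    and V_nonempty: "V w \<noteq> {}"
    and c_in_G: "c w \<in> G"
    and closed_cl_Cons: "w \<noteq> [] \<Longrightarrow> closed (insert (c w) (V w))"
    and c_notin_V: "w \<noteq> [] \<Longrightarrow> c w \<notin> V w"
    and c_Nil_notin: "c [] \<notin> V [b]"
    and child: "insert (c (w @ [b])) (V (w @ [b])) \<subseteq> V w"
    and siblings: "insert (c (w @ [True])) (V (w @ [True])) \<inter> insert (c (w @ [False])) (V (w @ [False])) = {}"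
    and diam: "\<lbrakk>w \<noteq> []; x \<in> insert (c w) (V w); y \<in> insert (c w) (V w)\<rbrakk> \<Longrightarrow> dist x y \<le> (1/2) ^ length w"
begin

section \<open>Nesting and disjointness of the closed pieces\<close>

definition cl :: "bool list \<Rightarrow> 'a set" where
  "cl w = insert (c w) (V w)"

definition R :: "bool list \<Rightarrow> 'a set" where
  "R w = cl w - V (w @ [True]) - V (w @ [False])"

lemma closed_G: "closed G"
  using compact_G compact_imp_closed by blast

lemma V_subset: "V w \<subseteq> G"
  using openin_V openin_imp_subset by blast

lemma cl_subset: "cl w \<subseteq> G"
  using V_subset c_in_G by (auto simp: cl_def)

lemma V_subset_cl: "V w \<subseteq> cl w"
  by (auto simp: cl_def)

lemma cl_Nil: "cl [] = G"
  using V_Nil c_in_G by (auto simp: cl_def)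

lemma closed_cl: "closed (cl w)"
  using closed_cl_Cons[of w] closed_G cl_Nil by (cases "w = []") (auto simp: cl_def)

lemma cl_child: "cl (w @ [b]) \<subseteq> V w"
  using child by (simp add: cl_def)

lemma cl_append: "cl (w @ v) \<subseteq> cl w"
proof (induction v rule: rev_induct)
  case (snoc b v)
  then show ?case
    using cl_child[of "w @ v" b] V_subset_cl[of "w @ v"] by auto
qed simp

lemma V_append: "V (w @ v) \<subseteq> V w"
proof (induction v rule: rev_induct)
  case (snoc b v)
  then show ?case
    using cl_child[of "w @ v" b] V_subset_cl[of "w @ v @ [b]"] by auto
qed simp

lemma V_take: "y \<in> V w \<Longrightarrow> y \<in> V (take n w)"
  using V_append[of "take n w" "drop n w"] by auto

lemma cl_butlast: "cl w \<subseteq> cl (butlast w)"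
  using cl_append[of "butlast w" "[last w]"] by (cases "w = []") auto

lemma cl_siblings: "b \<noteq> b' \<Longrightarrow> cl (w @ [b]) \<inter> cl (w @ [b']) = {}"
  using siblings[of w] by (cases b; cases b') (auto simp: cl_def)

lemma cl_disjoint: "\<lbrakk>length w = length w'; w \<noteq> w'\<rbrakk> \<Longrightarrow> cl w \<inter> cl w' = {}"
proof (induction w arbitrary: w' rule: rev_induct)
  case (snoc b w)
  then obtain u b' where w': "w' = u @ [b']"
    by (metis append_Nil2 length_0_conv rev_exhaust snoc_eq_iff_butlast)
  show ?case
  proof (cases "w = u")
    case True
    then show ?thesis
      using cl_siblings snoc.prems w' by simp
  next
    case False
    then have "cl w \<inter> cl u = {}"
      using snoc w' by simp
    then show ?thesis
      using cl_child[of w b] cl_child[of u b'] V_subset_cl[of w] V_subset_cl[of u] w' by blast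
  qed
qed simp

text \<open>Justifies the \<open>THE\<close> in \<open>F\<close>. The closed piece on one side also
  keeps the point \<open>c w\<close> out of every other open piece of the length of
  \<open>w\<close>.\<close>

lemma V_unique: "\<lbrakk>length w = length w'; y \<in> V w; y \<in> cl w'\<rbrakk> \<Longrightarrow> w = w'"
  using cl_disjoint[of w w'] V_subset_cl by blast

lemma dist_cl: "\<lbrakk>w \<noteq> []; x \<in> cl w; y \<in> cl w\<rbrakk> \<Longrightarrow> dist x y \<le> (1/2) ^ length w"
  using diam by (simp add: cl_def)

section \<open>Paths between consecutive cut points\<close>

lemma c_in_R: "c w \<in> R w"
proof (cases "w = []")
  case True
  then show ?thesis
    using c_Nil_notin by (simp add: R_def cl_def)
next
  case False
  then show ?thesis
    using c_notin_V[of w] cl_child[of w] V_subset_cl by (fastforce simp: R_def cl_def)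
qed

lemma c_child_in_R: "c (w @ [b]) \<in> R w"
proof -
  have "c (w @ [b]) \<notin> V (w @ [b'])" for b'
    using c_notin_V[of "w @ [b]"] V_unique[of "w @ [b']" "w @ [b]" "c (w @ [b])"] by (auto simp: cl_def)
  then show ?thesis
    using cl_child[of w b] by (auto simp: R_def cl_def)
qed

text \<open>Any path of \<open>G\<close> with the right ends works after composition with a
  retraction of \<open>G\<close> onto \<open>R w\<close>, which \<open>outer\<close> and the two
  maps \<open>inner\<close> provide. It fixes the ends because both cut points lie in
  \<open>R w\<close>.\<close>

lemma ex_path_in_R:
  "\<exists>g. continuous_on {0..1} g \<and> g ` {0..1} \<subseteq> R w \<and> g 0 = c w \<and> g (1::real) = c (w @ [b])"
proof -
  obtain g where g: "path g" "path_image g \<subseteq> G" "pathstart g = c w" "pathfinish g = c (w @ [b])"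
    using path_connected_G c_in_G unfolding path_connected_def by metis
  define outer where "outer = (\<lambda>y. if w = [] then y else if y \<in> V w then y else c w)"
  define inner where "inner = (\<lambda>b y. if y \<in> V (w @ [b]) then c (w @ [b]) else y)"
  have "continuous_on G outer"
    using continuous_on_collapse(2)[OF closed_G openin_V[of w] closed_cl_Cons[of w] c_in_G]
    by (cases "w = []") (simp_all add: outer_def)
  moreover have "continuous_on G (inner b)" for b
    unfolding inner_def by (intro continuous_on_collapse(1)[OF closed_G openin_V closed_cl_Cons c_in_G]) simp
  ultimately have cont: "continuous_on G outer" "\<And>b. continuous_on G (inner b)"
    by blast+
  have maps: "outer ` G \<subseteq> G" "\<And>b. inner b ` G \<subseteq> G" "outer ` G \<subseteq> cl w" "\<And>b. inner b ` cl w \<subseteq> cl w"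
    using c_in_G cl_child[of w] V_subset_cl[of w] cl_Nil by (auto simp: outer_def inner_def cl_def)
  define r where "r = inner True \<circ> inner False \<circ> outer"
  have contr: "continuous_on G r"
    unfolding r_def using cont maps(1,2)
    by (intro continuous_on_compose continuous_on_subset[OF cont(2)]) (auto simp: image_subset_iff)
  have "inner True (inner False y) \<in> R w" if "y \<in> cl w" for y
    using that c_child_in_R[of w True] c_child_in_R[of w False] by (auto simp: inner_def R_def)
  then have r: "r ` G \<subseteq> R w"
    using maps(3) by (auto simp: r_def)
  have id: "r y = y" if "y \<in> R w" for y
    using that by (auto simp: r_def inner_def outer_def R_def cl_def)
  have "continuous_on {0..1} (r \<circ> g)"
    using g(1,2) contr by (intro continuous_on_compose) (auto simp: path_def path_image_def intro: continuous_on_subset)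
  moreover have "(r \<circ> g) ` {0..1} \<subseteq> R w"
    using g(2) r by (auto simp: path_image_def)
  moreover have "(r \<circ> g) 0 = c w" "(r \<circ> g) 1 = c (w @ [b])"
    using g(3,4) id c_in_R c_child_in_R by (auto simp: pathstart_def pathfinish_def)
  ultimately show ?thesis
    by blast
qed

text \<open>The constant path at the empty word fits the general pattern, since
  \<open>butlast [] = []\<close>; \<open>F\<close> uses it on one-letter words, whose
  \<open>tl\<close> is empty.\<close>

definition arc_to :: "bool list \<Rightarrow> real \<Rightarrow> 'a" where
  "arc_to w = (if w = [] then (\<lambda>_. c []) else SOME g. continuous_on {0..1} g \<and>
     g ` {0..1} \<subseteq> R (butlast w) \<and> g 0 = c (butlast w) \<and> g 1 = c w)"

lemma arc_to:
  "continuous_on {0..1} (arc_to w)" "t \<in> {0..1} \<Longrightarrow> arc_to w t \<in> R (butlast w)"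
  "arc_to w 0 = c (butlast w)" "arc_to w 1 = c w"
proof -
  have "continuous_on {0..1} (arc_to w) \<and> arc_to w ` {0..1} \<subseteq> R (butlast w) \<and>
    arc_to w 0 = c (butlast w) \<and> arc_to w 1 = c w"
  proof (cases "w = []")
    case True
    then show ?thesis
      using c_in_R[of "[]"] by (auto simp: arc_to_def)
  next
    case False
    then show ?thesis
      using someI_ex[OF ex_path_in_R[of "butlast w" "last w"]] by (simp add: arc_to_def)
  qed
  then show "continuous_on {0..1} (arc_to w)" "t \<in> {0..1} \<Longrightarrow> arc_to w t \<in> R (butlast w)"
    "arc_to w 0 = c (butlast w)" "arc_to w 1 = c w"
    by auto
qed

lemma ex_gap:
  assumes "w \<noteq> []"
  shows "\<exists>d>0. \<forall>b. \<forall>y \<in> cl (w @ [b]). d \<le> dist y (c w)"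
proof -
  define K where "K = cl (w @ [True]) \<union> cl (w @ [False])"
  have "closed K" "c w \<notin> K"
    using closed_cl cl_child[of w] c_notin_V[OF assms] by (auto simp: K_def)
  then have "open (- K)" "c w \<in> - K"
    by auto
  then obtain d where "d > 0" "ball (c w) d \<subseteq> - K"
    by (meson openE)
  moreover have "cl (w @ [b]) \<subseteq> K" for b
    by (cases b) (auto simp: K_def)
  ultimately have "\<forall>b. \<forall>y \<in> cl (w @ [b]). d \<le> dist y (c w)"
    by (metis ComplD dist_commute in_mono linorder_not_le mem_ball)
  with \<open>d > 0\<close> show ?thesis
    by blast
qed

definition gap :: "bool list \<Rightarrow> real" where
  "gap w = (SOME d. d > 0 \<and> (\<forall>b. \<forall>y \<in> cl (w @ [b]). d \<le> dist y (c w)))"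

text \<open>A Urysohn function that serves as path parameter: 0 at the boundary point, where the
  image has to match the previous stage, and 1 on the closed successor pieces, where the image is
  constant until the next stage.\<close>

definition height :: "bool list \<Rightarrow> 'a \<Rightarrow> real" where
  "height w y = min 1 (dist y (c w) / gap w)"

lemma gap: assumes "w \<noteq> []" shows "gap w > 0" "y \<in> cl (w @ [b]) \<Longrightarrow> gap w \<le> dist y (c w)"
  using someI_ex[OF ex_gap[OF assms]] unfolding gap_def by blast+

lemma height:
  assumes "w \<noteq> []"
  shows "continuous_on S (height w)" "height w y \<in> {0..1}" "height w (c w) = 0"
    "y \<in> cl (w @ [b]) \<Longrightarrow> height w y = 1"
proof -
  show "continuous_on S (height w)"
    unfolding height_def using gap(1)[OF assms] by (intro continuous_intros) auto
qed (use gap[OF assms] in \<open>auto simp: height_def min_def field_simps not_le\<close>)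

end

section \<open>The approximating maps\<close>

locale cut_scheme_language = cut_scheme +
  fixes L :: "bool list set"
  assumes Nil_L: "[] \<in> L" and tl_L: "w \<in> L \<Longrightarrow> tl w \<in> L" and butlast_L: "w \<in> L \<Longrightarrow> butlast w \<in> L"
begin

text \<open>Pieces of forbidden words are never touched again: they keep the constant value given by
  their longest allowed prefix, which is how points outside the subshift are sent towards
  \<open>c []\<close>.\<close>

primrec F :: "nat \<Rightarrow> 'a \<Rightarrow> 'a" where
  "F 0 y = c []"
| "F (Suc n) y = (if \<exists>w\<in>L. length w = Suc n \<and> y \<in> V w
     then let w = (THE w. length w = Suc n \<and> y \<in> V w) in arc_to (tl w) (height w y) else F n y)"

lemma F_V:
  assumes "w \<in> L" "w \<noteq> []" "y \<in> V w"
  shows "F (length w) y = arc_to (tl w) (height w y)"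
proof -
  obtain n where n: "length w = Suc n"
    using assms(2) by (cases w) auto
  have "(THE w. length w = Suc n \<and> y \<in> V w) = w"
    using assms n V_subset_cl[of w] V_unique[of _ w y] by (intro the_equality) auto
  then show ?thesis
    using assms n by auto
qed

lemma F_Suc_eq: "\<not> (\<exists>w\<in>L. length w = Suc n \<and> y \<in> V w) \<Longrightarrow> F (Suc n) y = F n y"
  by auto

declare F.simps(2) [simp del]

lemma F_child: "\<lbrakk>w \<in> L; y \<in> cl (w @ [b])\<rbrakk> \<Longrightarrow> F (length w) y = c (tl w)"
  using F_V[of w y] cl_child[of w b] height(4)[of w y b] arc_to(4)[of "tl w"] by (cases "w = []") auto

text \<open>At the boundary point stage \<open>length w\<close> changes nothing, and the previous
  stage has the value \<open>c (tl (butlast w))\<close> there, exactly the start of the new path.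
  This matching makes the stages continuous.\<close>

lemma F_cl:
  assumes "w \<in> L" "w \<noteq> []" "y \<in> cl w"
  shows "F (length w) y = arc_to (tl w) (height w y)"
proof (cases "y \<in> V w")
  case False
  then have y: "y = c w"
    using assms(3) by (simp add: cl_def)
  obtain v b where w: "w = v @ [b]"
    using assms(2) rev_exhaust by blast
  have "\<not> (\<exists>w'\<in>L. length w' = length w \<and> y \<in> V w')"
    using V_unique[of _ w y] assms False by blast
  then have "F (length w) y = F (length v) y"
    using F_Suc_eq[of "length v" y] by (simp add: w)
  also have "\<dots> = c (tl v)"
    using F_child[of v y b] assms butlast_L[of w] by (simp add: w)
  also have "\<dots> = arc_to (tl w) 0"
    using arc_to(3)[of "tl w"] by (cases v) (auto simp: w)
  finally show ?thesis
    using height(3)[OF assms(2)] y by simp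
qed (use F_V assms in blast)

text \<open>The index bounds the number of iterations after which a point rests at
  \<open>c []\<close>. \<open>D 0\<close> is empty because \<open>V [] = G\<close> and the empty
  word is allowed.\<close>

definition D :: "nat \<Rightarrow> 'a set" where
  "D n = {y \<in> G. \<forall>w\<in>L. length w = n \<longrightarrow> y \<notin> V w}"

lemma finite_words: "finite {w \<in> L. length w = n}"
  by (rule finite_subset[OF _ finite_lists_length_eq[of "UNIV :: bool set" n]]) auto

lemma closed_D: "closed (D n)"
proof -
  have "openin (top_of_set G) (\<Union>w\<in>{w\<in>L. length w = n}. V w)"
    by (intro openin_Union) (auto simp: openin_V)
  moreover have "D n = G - (\<Union>w\<in>{w\<in>L. length w = n}. V w)"
    by (auto simp: D_def)
  ultimately show ?thesis
    using closed_G by (metis closedin_closed_trans closedin_diff closedin_self topspace_euclidean_subtopology)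
qed

text \<open>A finite closed cover of \<open>G\<close>: the new formula holds on the closed pieces by
  \<open>F_cl\<close>, the old one on the remainder \<open>D (Suc n)\<close>.\<close>

lemma continuous_F: "continuous_on G (F n)"
proof (induction n)
  case 0
  have "F 0 = (\<lambda>_. c [])"
    by auto
  then show ?case
    by simp
next
  case (Suc n)
  define I where "I = {w \<in> L. length w = Suc n}"
  have "continuous_on (\<Union>w\<in>I. cl w) (F (Suc n))"
  proof (rule continuous_on_closed_Union)
    show "finite I"
      unfolding I_def by (rule finite_words)
    show "continuous_on (cl w) (F (Suc n))" if "w \<in> I" for w
    proof -
      have w: "w \<in> L" "w \<noteq> []" "length w = Suc n"
        using that by (auto simp: I_def)
      have "continuous_on (cl w) (arc_to (tl w) \<circ> height w)"
        using height[OF w(2)] arc_to(1)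
        by (intro continuous_on_compose continuous_on_subset[OF arc_to(1)]) auto
      then show ?thesis
        using F_cl[OF w(1,2)] w(3) by (auto intro: continuous_on_eq)
    qed
  qed (rule closed_cl)
  moreover have "continuous_on (D (Suc n)) (F (Suc n))"
  proof (rule continuous_on_eq)
    show "continuous_on (D (Suc n)) (F n)"
      by (rule continuous_on_subset[OF Suc]) (auto simp: D_def)
  qed (auto simp: D_def F_Suc_eq)
  moreover have "closed (\<Union>w\<in>I. cl w)"
    using finite_words[of "Suc n"] closed_cl by (auto simp: I_def)
  moreover have "G = (\<Union>w\<in>I. cl w) \<union> D (Suc n)"
    using cl_subset V_subset_cl by (fastforce simp: I_def D_def)
  ultimately show ?case
    using continuous_on_closed_Un closed_D by metis
qed

lemma D_mono: "n \<le> m \<Longrightarrow> D n \<subseteq> D m"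
proof (induction m rule: dec_induct)
  case (step m)
  have "D m \<subseteq> D (Suc m)"
  proof
    fix y assume y: "y \<in> D m"
    have "y \<notin> V w" if w: "w \<in> L" "length w = Suc m" for w
    proof
      assume "y \<in> V w"
      then have "y \<in> V (butlast w)"
        using V_take[of y w m] w(2) by (simp add: butlast_conv_take)
      then show False
        using y butlast_L[OF w(1)] w(2) by (auto simp: D_def)
    qed
    then show "y \<in> D (Suc m)"
      using y by (auto simp: D_def)
  qed
  with step show ?case
    by blast
qed simp

lemma F_Suc_D: "y \<in> D (Suc n) \<Longrightarrow> F (Suc n) y = F n y"
  by (intro F_Suc_eq) (auto simp: D_def)

lemma F_stable: "\<lbrakk>n \<le> m; y \<in> D n\<rbrakk> \<Longrightarrow> F m y = F n y"
proof (induction m rule: dec_induct)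
  case (step m)
  then show ?case
    using F_Suc_D[of y m] D_mono[of n "Suc m"] by auto
qed simp

lemma R_subset_D: "R w \<subseteq> D (Suc (length w))"
proof
  fix y assume y: "y \<in> R w"
  have "y \<notin> V v" if v: "length v = Suc (length w)" for v
  proof
    assume yv: "y \<in> V v"
    then have "y \<in> V (take (length w) v)"
      by (rule V_take)
    then have "take (length w) v = w"
      using V_unique[of "take (length w) v" w y] y v by (simp add: R_def)
    then have "v = w @ [v ! length w]"
      using v by (metis lessI order_refl take_Suc_conv_app_nth take_all)
    then show False
      using yv y unfolding R_def by (cases "v ! length w") auto
  qed
  then show "y \<in> D (Suc (length w))"
    using y cl_subset by (auto simp: D_def R_def)
qed

lemma c_Nil_in_D: "n \<ge> 1 \<Longrightarrow> c [] \<in> D n"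
  using c_in_R[of "[]"] R_subset_D[of "[]"] D_mono[of 1 n] by auto

lemma F_cases:
  assumes "y \<in> G"
  obtains "F n y = c []" | w where "w \<in> L" "w \<noteq> []" "length w \<le> n" "y \<in> V w" "F n y \<in> R (butlast (tl w))"
  using assms
proof (induction n arbitrary: thesis)
  case (Suc n)
  show ?case
  proof (cases "\<exists>w\<in>L. length w = Suc n \<and> y \<in> V w")
    case True
    then obtain w where w: "w \<in> L" "length w = Suc n" "y \<in> V w"
      by blast
    then have "F (Suc n) y \<in> R (butlast (tl w))"
      using F_V[of w y] arc_to(2)[of "height w y" "tl w"] height(2)[of w y] by fastforce
    then show ?thesis
      using w by (intro Suc.prems(2)[of w]) auto
  next
    case False
    then have "F (Suc n) y = F n y"
      by (rule F_Suc_eq)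
    then show ?thesis
      using Suc.IH[OF _ _ Suc.prems(3)] Suc.prems(1,2) by (metis le_SucI)
  qed
qed simp

text \<open>A value in \<open>R (butlast (tl w))\<close> has left the scheme by level
  \<open>length w - 1\<close>, or level 1 if \<open>w\<close> has one letter, hence no later than
  level \<open>n\<close>.\<close>

lemma F_in_D:
  assumes "n \<ge> 1" "y \<in> G"
  shows "F n y \<in> D n"
proof (cases rule: F_cases[OF assms(2), of n])
  case 1
  then show ?thesis
    using c_Nil_in_D[OF assms(1)] by simp
next
  case (2 w)
  have "Suc (length (butlast (tl w))) \<le> n"
    using 2(2,3) assms(1) by (cases w) auto
  then show ?thesis
    using 2(5) R_subset_D D_mono by blast
qed

text \<open>Two letters are lost: the first to the shift, the last because the path to
  \<open>c (tl w)\<close> lives in the parent piece. Later stages act on words extending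
  \<open>w\<close>, whose images stay inside that piece.\<close>

lemma F_nested:
  assumes w: "w \<in> L" "w \<noteq> []" "y \<in> V w" and "length w \<le> m"
  shows "F m y \<in> cl (butlast (tl w))"
  using assms(4)
proof (induction m rule: dec_induct)
  case base
  show ?case
    using F_V[OF w] arc_to(2)[of "height w y" "tl w"] height(2)[OF w(2)] by (auto simp: R_def)
next
  case (step m)
  show ?case
  proof (cases "\<exists>v\<in>L. length v = Suc m \<and> y \<in> V v")
    case True
    then obtain v where v: "v \<in> L" "length v = Suc m" "y \<in> V v"
      by blast
    have "take (length w) v = w"
      using V_unique[of "take (length w) v" w y] V_take[of y v] w V_subset_cl v step by auto
    then have v_eq: "v = w @ drop (length w) v"
      by (metis append_take_drop_id)
    then have "tl v = tl w @ drop (length w) v" "drop (length w) v \<noteq> []"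
      using w(2) v(2) step by (metis tl_append2, simp)
    then have "butlast (tl v) = tl w @ butlast (drop (length w) v)"
      by (simp add: butlast_append)
    then have "cl (butlast (tl v)) \<subseteq> cl (butlast (tl w))"
      using cl_append[of "tl w"] cl_butlast[of "tl w"] by auto
    moreover have "v \<noteq> []"
      using v(2) by auto
    then have "F (Suc m) y \<in> R (butlast (tl v))"
      using F_V[of v y] v arc_to(2)[of "height v y" "tl v"] height(2)[of v y] by auto
    ultimately show ?thesis
      by (auto simp: R_def)
  next
    case False
    then have "F (Suc m) y = F m y"
      by (rule F_Suc_eq)
    then show ?thesis
      using step by simp
  qed
qed

text \<open>A word of length \<open>n + 3\<close> loses two letters, which leaves a piece of
  diameter at most \<open>(1/2) ^ Suc n\<close>; a point in no allowed piece of that length has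
  already reached its final value.\<close>

lemma dist_F:
  assumes "y \<in> G" "m \<ge> n + 3" "k \<ge> n + 3"
  shows "dist (F m y) (F k y) \<le> (1/2) ^ Suc n"
proof (cases "y \<in> D (n + 3)")
  case True
  then have "F m y = F k y"
    using F_stable[OF assms(2) True] F_stable[OF assms(3) True] by metis
  then show ?thesis
    by (metis dist_self zero_le_power zero_le_divide_1_iff zero_le_numeral)
next
  case False
  then obtain w where w: "w \<in> L" "length w = n + 3" "y \<in> V w"
    using assms(1) by (auto simp: D_def)
  define v where "v = butlast (tl w)"
  have len: "w \<noteq> []" "length v = Suc n"
    using w(2) by (auto simp: v_def)
  have "F m y \<in> cl v" "F k y \<in> cl v"
    unfolding v_def by (rule F_nested[OF w(1) len(1) w(3)]; use w(2) assms in linarith)+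
  moreover have "v \<noteq> []"
    using len(2) by (metis list.size(3) nat.distinct(1))
  ultimately show ?thesis
    using dist_cl[of v] len(2) by metis
qed

section \<open>The limit map\<close>

definition f :: "'a \<Rightarrow> 'a" where
  "f y = lim (\<lambda>n. F n y)"

lemma F_tendsto:
  assumes y: "y \<in> G"
  shows "(\<lambda>n. F n y) \<longlonglongrightarrow> f y" "f y \<in> G"
proof -
  define h where "h = (\<lambda>n. F (n + 3) y)"
  have "Cauchy h"
  proof (rule geometric_step_Cauchy)
    fix n
    have "dist (h n) (h (Suc n)) \<le> (1/2) ^ Suc n"
      unfolding h_def using y by (intro dist_F) auto
    then show "dist (h n) (h (Suc n)) \<le> (1/2) ^ n"
      by (rule order_trans) simp
  qed
  moreover have "h n \<in> G" for n
    using F_in_D[of "n + 3" y] y by (auto simp: h_def D_def)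
  ultimately obtain l where "l \<in> G" "h \<longlonglongrightarrow> l"
    using compact_imp_complete[OF compact_G] unfolding complete_def by blast
  then have "l \<in> G" "(\<lambda>n. F n y) \<longlonglongrightarrow> l"
    unfolding h_def by (blast intro: LIMSEQ_offset[of _ 3])+
  then show "(\<lambda>n. F n y) \<longlonglongrightarrow> f y" "f y \<in> G"
    unfolding f_def by (auto dest: limI)
qed

lemma continuous_f: "continuous_on G f"
proof (rule uniform_limit_theorem)
  show "uniform_limit G F f sequentially"
  proof (rule uniform_limitI)
    fix e :: real assume "e > 0"
    then obtain n where n: "(1/2::real)^n < e"
      using real_arch_pow_inv[of e "1/2"] by auto
    have "dist (F m y) (f y) < e" if y: "y \<in> G" and m: "m \<ge> n + 3" for y m
    proof -
      have "dist (F m y) (f y) \<le> (1/2) ^ Suc n"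
      proof (rule LIMSEQ_le_const2)
        show "(\<lambda>k. dist (F m y) (F k y)) \<longlonglongrightarrow> dist (F m y) (f y)"
          by (intro tendsto_intros F_tendsto y)
      qed (use dist_F[OF y m] in blast)
      then show ?thesis
        using n zero_le_dist[of "F m y" "f y"] by (simp del: zero_le_dist)
    qed
    then show "\<forall>\<^sub>F n in sequentially. \<forall>x\<in>G. dist (F n x) (f x) < e"
      unfolding eventually_sequentially by blast
  qed
qed (auto simp: continuous_F)

text \<open>The relevant stage is one below the index of the set. Together with
  \<open>F_in_D\<close> this makes \<open>f\<close> map \<open>D (Suc n)\<close> into
  \<open>D n\<close> for \<open>n \<ge> 1\<close>, the descent behind
  \<open>iterate_f_D\<close>.\<close>

lemma f_D: "y \<in> D (Suc n) \<Longrightarrow> f y = F n y"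
proof -
  assume y: "y \<in> D (Suc n)"
  then have "y \<in> G"
    by (simp add: D_def)
  have "(\<lambda>m. F m y) \<longlonglongrightarrow> F (Suc n) y"
    by (intro tendsto_eventually eventually_sequentiallyI[of "Suc n"] F_stable y)
  then show ?thesis
    using F_tendsto(1)[OF \<open>y \<in> G\<close>] F_Suc_D[OF y] LIMSEQ_unique by metis
qed

lemma iterate_f_D: "y \<in> D n \<Longrightarrow> (f ^^ n) y = c []"
proof (induction n arbitrary: y)
  case 0
  then show ?case
    using Nil_L V_Nil by (auto simp: D_def)
next
  case (Suc n)
  show ?case
  \<comment> \<open>The descent ends at \<open>D 1\<close>, on which \<open>f\<close> agrees with
    the constant stage 0.\<close>
  proof (cases "n = 0")
    case True
    then show ?thesis
      using f_D[OF Suc.prems] by simp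
  next
    case False
    then have "f y \<in> D n"
      using f_D[OF Suc.prems] F_in_D[of n y] Suc.prems by (auto simp: D_def)
    then show ?thesis
      using Suc.IH by (simp add: funpow_Suc_right del: funpow.simps)
  qed
qed

section \<open>Points coded by binary sequences\<close>

definition pt :: "(nat \<Rightarrow> bool) \<Rightarrow> 'a" where
  "pt s = (SOME y. \<forall>n. y \<in> V (pref s n))"

lemma cl_pref_imp_V: "(\<And>n. y \<in> cl (pref s n)) \<Longrightarrow> y \<in> V (pref s n)"
  using cl_child[of "pref s n" "s n"] by (metis pref_Suc subsetD)

text \<open>The cut points along \<open>s\<close> form a Cauchy sequence. Its limit lies in all
  closed pieces, and each of these sits in the open piece one level up.\<close>

lemma pt_in_V: "pt s \<in> V (pref s n)"
proof -
  define h where "h = (\<lambda>n. c (pref s (Suc n)))"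
  have h: "h n \<in> cl (pref s (Suc n))" for n
    by (simp add: h_def cl_def)
  have nest: "cl (pref s m) \<subseteq> cl (pref s n)" if "n \<le> m" for n m
    using that
  proof (induction m rule: dec_induct)
    case (step m)
    then show ?case
      using cl_append[of "pref s m" "[s m]"] by (auto simp: pref_Suc)
  qed simp
  have "dist (h n) (h (Suc n)) \<le> (1/2)^n" for n
  proof -
    have "dist (h n) (h (Suc n)) \<le> (1/2) ^ Suc n"
      using dist_cl[of "pref s (Suc n)" "h n" "h (Suc n)"] h[of n] h[of "Suc n"] nest[of "Suc n" "Suc (Suc n)"]
      by (auto simp: pref_Suc)
    then show ?thesis
      by (rule order_trans) simp
  qed
  then have "Cauchy h"
    by (rule geometric_step_Cauchy)
  moreover have "h n \<in> G" for n
    by (simp add: h_def c_in_G)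
  ultimately obtain l where l: "h \<longlonglongrightarrow> l"
    using compact_imp_complete[OF compact_G] unfolding complete_def by blast
  have "l \<in> cl (pref s n)" for n
  proof (rule closed_sequentially[OF closed_cl _ LIMSEQ_ignore_initial_segment[OF l, of n]])
    show "h (m + n) \<in> cl (pref s n)" for m
      using h[of "m + n"] nest[of n "Suc (m + n)"] by auto
  qed
  then have "\<exists>y. \<forall>n. y \<in> V (pref s n)"
    using cl_pref_imp_V by blast
  then show ?thesis
    unfolding pt_def by (rule someI2_ex) blast
qed

lemma pt_eqI:
  assumes "\<And>n. y \<in> cl (pref s n)"
  shows "y = pt s"
proof (rule ccontr)
  assume "y \<noteq> pt s"
  then obtain n where n: "(1/2::real)^n < dist y (pt s)"
    using real_arch_pow_inv[of "dist y (pt s)" "1/2"] by auto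
  have "pref s (Suc n) \<noteq> []"
    by (simp add: pref_Suc)
  then have "dist y (pt s) \<le> (1/2)^Suc n"
    using dist_cl[of "pref s (Suc n)" y "pt s"] assms[of "Suc n"] pt_in_V[of s "Suc n"] by (auto simp: cl_def)
  also have "\<dots> \<le> (1/2)^n"
    by simp
  finally show False
    using n by simp
qed

lemma pt_in_G: "pt s \<in> G"
  using pt_in_V V_subset by blast

text \<open>The prefix of length \<open>n + 2\<close> confines the image to a closed piece of length
  \<open>n\<close> at every late stage, hence in the limit; these pieces shrink to the point coded
  by the shifted sequence.\<close>

lemma f_pt:
  assumes "s \<in> shift_space L"
  shows "f (pt s) = pt (s \<circ> Suc)"
proof (rule pt_eqI)
  fix n
  define w where "w = pref s (Suc (Suc n))"
  have len: "length w = Suc (Suc n)"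
    by (simp add: w_def)
  then have "w \<noteq> []"
    by auto
  moreover have "w \<in> L" "pt s \<in> V w"
    using assms pt_in_V[of s "Suc (Suc n)"] by (auto simp: w_def shift_space_def)
  ultimately have w: "w \<in> L" "w \<noteq> []" "pt s \<in> V w"
    by blast+
  have "f (pt s) \<in> cl (butlast (tl w))"
  proof (rule closed_sequentially[OF closed_cl _ LIMSEQ_ignore_initial_segment])
    show "F (m + length w) (pt s) \<in> cl (butlast (tl w))" for m
      using F_nested[OF w(1-3)] by simp
  qed (rule F_tendsto(1)[OF pt_in_G])
  then show "f (pt s) \<in> cl (pref (s \<circ> Suc) n)"
    by (simp add: w_def tl_pref butlast_pref del: o_apply)
qed

text \<open>Pieces of equal length are disjoint, so the words of a point that stays in allowed
  pieces of all lengths are the prefixes of one sequence.\<close>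

lemma G_cases:
  assumes "y \<in> G"
  obtains n where "y \<in> D n" | s where "s \<in> shift_space L" "y = pt s"
proof (cases "\<exists>n. y \<in> D n")
  case False
  then have "\<exists>w. w \<in> L \<and> length w = n \<and> y \<in> V w" for n
    using assms by (auto simp: D_def)
  then obtain w where w: "\<And>n. w n \<in> L" "\<And>n. length (w n) = n" "\<And>n. y \<in> V (w n)"
    by metis
  have take: "take k (w n) = w k" if "k \<le> n" for k n
    using V_unique[of "take k (w n)" "w k" y] V_take[OF w(3)[of n], of k] w V_subset_cl[of "w k"] that
    by auto
  define s where "s = (\<lambda>n. w (Suc n) ! n)"
  have pref: "pref s n = w n" for n
  proof (rule nth_equalityI)
    fix i assume "i < length (pref s n)"
    then have "i < n"
      by simp
    then show "pref s n ! i = w n ! i"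
      using take[of "Suc i" n] nth_take[of i "Suc i" "w n"] by (simp add: pref_def s_def)
  qed (simp add: w)
  moreover have "y \<in> cl (w n)" for n
    using w(3) V_subset_cl by blast
  ultimately have "s \<in> shift_space L" "y = pt s"
    using w by (auto simp: shift_space_def intro!: pt_eqI)
  then show thesis
    by (rule that(2))
qed (use that in blast)

lemma dist_pt:
  assumes "pref s n = pref s' n" "n > 0"
  shows "dist (pt s) (pt s') \<le> (1/2)^n"
  using dist_cl[of "pref s n" "pt s" "pt s'"] pt_in_V[of s n] pt_in_V[of s' n] assms
  by (cases "pref s n = []") (auto simp: cl_def simp flip: length_0_conv)

text \<open>\<open>V (pref s n)\<close> is a relative neighbourhood of \<open>pt s\<close> without
  coded points of another prefix, so closeness of coded points controls their letters.\<close>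

lemma pt_near_imp_pref_eq:
  obtains e where "e > 0" "\<And>s'. dist (pt s') (pt s) < e \<Longrightarrow> pref s' n = pref s n"
proof -
  obtain T where T: "open T" "V (pref s n) = G \<inter> T"
    using openin_V[of "pref s n"] by (auto simp: openin_open)
  then obtain e where e: "e > 0" "ball (pt s) e \<subseteq> T"
    using pt_in_V[of s n] openE[of T "pt s"] by auto
  show thesis
  proof (rule that[OF e(1)])
    fix s' assume "dist (pt s') (pt s) < e"
    then have "pt s' \<in> V (pref s n)"
      using T(2) e(2) pt_in_G by (auto simp: dist_commute)
    then show "pref s' n = pref s n"
      using V_unique[of "pref s n" "pref s' n" "pt s'"] pt_in_V[of s' n] by (auto simp: cl_def)
  qed
qed

end

section \<open>Cantor schemes at the end points\<close>

text \<open>Order at most 1 gives a neighbourhood with at most one boundary point; connectedness of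
  \<open>G\<close> excludes an empty boundary, because the neighbourhood is a proper nonempty part
  of \<open>G\<close>.\<close>

lemma cut_point_neighbourhood:
  fixes G :: "'a::metric_space set"
  assumes "compact G" "connected G" "order_at_most G e 1" "openin (top_of_set G) U" "e \<in> U" "U \<noteq> G"
  obtains V c where "openin (top_of_set G) V" "e \<in> V" "insert c V \<subseteq> U" "c \<notin> V" "closed (insert c V)"
proof -
  obtain T where T: "open T" "U = G \<inter> T"
    using assms(4) by (auto simp: openin_open)
  \<comment> \<open>The closed ball keeps the closure of \<open>V\<close>, and with it the boundary
    point, inside \<open>U\<close>.\<close>
  then obtain r where r: "r > 0" "cball e r \<subseteq> T"
    using assms(5) open_contains_cball[of T] by auto
  have "openin (top_of_set G) (G \<inter> ball e r)" "e \<in> G \<inter> ball e r"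
    using assms(5) T(2) r(1) by (auto simp: openin_open_Int)
  then obtain V where V: "openin (top_of_set G) V" "e \<in> V" "V \<subseteq> G \<inter> ball e r"
      "finite (top_of_set G frontier_of V)" "card (top_of_set G frontier_of V) \<le> 1"
    using assms(3) unfolding order_at_most_def by metis
  define K where "K = top_of_set G closure_of V"
  have fr: "top_of_set G frontier_of V = K - V"
    using V(1) by (simp add: frontier_of_def interior_of_openin K_def)
  have K: "closedin (top_of_set G) K" "V \<subseteq> K"
    using V(1) by (auto simp: K_def closure_of_subset openin_imp_subset)
  have "V \<subseteq> U"
    using V(3) T(2) r(2) ball_subset_cball by blast
  have "K - V \<noteq> {}"
  proof
    assume "K - V = {}"
    then have "V = K"
      using K(2) by blast
    then have "V = {} \<or> V = G"
      using assms(2) V(1) K(1) by (auto simp: connected_clopen)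
    then show False
      using V(2) \<open>V \<subseteq> U\<close> assms(4,6) openin_imp_subset by blast
  qed
  then obtain c where "K - V = {c}"
    using V(4,5) unfolding fr by (metis One_nat_def card_1_singletonE card_0_eq le_antisym less_one linorder_not_less)
  then have c: "K = insert c V" "c \<notin> V"
    using K(2) by blast+
  have "V \<subseteq> cball e r"
    using V(3) by auto
  then have "K \<subseteq> cball e r"
    unfolding K_def using closure_of_subtopology_subset[of euclidean G V] closure_minimal[of V "cball e r"] by auto
  moreover have "K \<subseteq> G"
    using K(1) closedin_imp_subset by blast
  ultimately have "insert c V \<subseteq> U"
    using c(1) T(2) r(2) by blast
  moreover have "closed (insert c V)"
    using K(1) c(1) assms(1) closedin_closed_trans compact_imp_closed by blast
  ultimately show thesis
    using that V(1,2) c(2) by blast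
qed

lemma two_cut_point_neighbourhoods:
  fixes G :: "'a::metric_space set"
  assumes "compact G" "connected G" "E \<subseteq> G" "\<And>e. e \<in> E \<Longrightarrow> order_at_most G e 1"
    and perfect: "\<And>e r. \<lbrakk>e \<in> E; r > 0\<rbrakk> \<Longrightarrow> \<exists>e'\<in>E. e' \<noteq> e \<and> dist e e' < r"
    and W: "openin (top_of_set G) W" "E \<inter> W \<noteq> {}" and "r > 0"
  shows "\<exists>q. (\<forall>b. openin (top_of_set G) (fst (q b)) \<and> E \<inter> fst (q b) \<noteq> {} \<and> snd (q b) \<notin> fst (q b) \<and>
      closed (insert (snd (q b)) (fst (q b))) \<and> insert (snd (q b)) (fst (q b)) \<subseteq> W \<and>
      (\<forall>x\<in>insert (snd (q b)) (fst (q b)). \<forall>y\<in>insert (snd (q b)) (fst (q b)). dist x y \<le> r)) \<and>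
      insert (snd (q True)) (fst (q True)) \<inter> insert (snd (q False)) (fst (q False)) = {}"
proof -
  obtain e where e: "e \<in> E" "e \<in> W"
    using W(2) by blast
  obtain T where T: "open T" "W = G \<inter> T"
    using W(1) by (auto simp: openin_open)
  then obtain s where s: "s > 0" "ball e s \<subseteq> T"
    using e openE by blast
  obtain e' where e': "e' \<in> E" "e' \<noteq> e" "dist e e' < s"
    using perfect[OF e(1) s(1)] by blast
  then have "e' \<in> W"
    using T(2) s(2) assms(3) by auto
  \<comment> \<open>\<open>r/2\<close> bounds the diameters. Half the distance of the two end points
    makes the balls disjoint, and each ball misses the other end point, so it is not all of
    \<open>G\<close>.\<close>
  define d where "d = min (r/2) (dist e e' / 2)"
  have d: "d > 0" "2 * d \<le> r" "2 * d \<le> dist e e'"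
    using e'(2) \<open>r > 0\<close> by (auto simp: d_def)
  have "\<exists>V c. openin (top_of_set G) V \<and> x \<in> V \<and> insert c V \<subseteq> W \<inter> ball x d \<and> c \<notin> V \<and> closed (insert c V)"
    if "x \<in> {e, e'}" for x
  proof -
    have "openin (top_of_set G) (W \<inter> ball x d)"
      using W(1) by (metis inf_commute open_ball openin_Int openin_open openin_subtopology_Int2 T(2) inf_assoc open_Int T(1))
    moreover have "x \<in> W \<inter> ball x d"
      using that d(1) e(2) \<open>e' \<in> W\<close> by auto
    moreover have "W \<inter> ball x d \<noteq> G"
    proof
      assume "W \<inter> ball x d = G"
      then have "e \<in> ball x d" "e' \<in> ball x d"
        using e(1) e'(1) assms(3) by auto
      then show False
        using that d by (auto simp: dist_commute)
    qed
    moreover have "order_at_most G x 1"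
      using that e(1) e'(1) assms(4) by blast
    ultimately show ?thesis
      using cut_point_neighbourhood[OF assms(1,2)] by metis
  qed
  then obtain V c where V: "\<And>x. x \<in> {e, e'} \<Longrightarrow> openin (top_of_set G) (V x) \<and> x \<in> V x \<and>
      insert (c x) (V x) \<subseteq> W \<inter> ball x d \<and> c x \<notin> V x \<and> closed (insert (c x) (V x))"
    by metis
  have diam: "dist y z \<le> r" if "x \<in> {e, e'}" "y \<in> insert (c x) (V x)" "z \<in> insert (c x) (V x)" for x y z
  proof -
    have "dist x y < d" "dist x z < d"
      using V[OF that(1)] that(2,3) by auto
    then show ?thesis
      using d(2) dist_triangle3[of y z x] by linarith
  qed
  have "insert (c e) (V e) \<inter> insert (c e') (V e') = {}"
  proof (rule ccontr)
    assume "insert (c e) (V e) \<inter> insert (c e') (V e') \<noteq> {}"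
    then obtain z where "z \<in> insert (c e) (V e)" "z \<in> insert (c e') (V e')"
      by blast
    then have "z \<in> ball e d" "z \<in> ball e' d"
      using V[of e] V[of e'] by blast+
    then show False
      using d(3) dist_triangle2[of e e' z] by (auto simp: dist_commute)
  qed
  moreover define z where "z = (\<lambda>b. if b then e else e')"
  ultimately have disj: "insert (c (z True)) (V (z True)) \<inter> insert (c (z False)) (V (z False)) = {}"
    by simp
  have z: "z b \<in> {e, e'}" "z b \<in> E" for b
    using e(1) e'(1) by (auto simp: z_def)
  show ?thesis
    by (intro exI[of _ "\<lambda>b. (V (z b), c (z b))"] conjI allI ballI; unfold fst_conv snd_conv)
      (use z V[OF z(1)] diam[OF z(1)] disj in blast)+
qed

lemma ex_cut_scheme:
  fixes G :: "'a::metric_space set"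
  assumes "compact G" "connected G" "locally connected G"
    and E: "E \<noteq> {}" "E \<subseteq> G" "\<And>e. e \<in> E \<Longrightarrow> order_at_most G e 1"
    and perfect: "\<And>e r. \<lbrakk>e \<in> E; r > 0\<rbrakk> \<Longrightarrow> \<exists>e'\<in>E. e' \<noteq> e \<and> dist e e' < r"
  obtains V c where "cut_scheme G V c"
proof -
  define good where "good W \<longleftrightarrow> openin (top_of_set G) W \<and> E \<inter> W \<noteq> {}" for W
  define step where "step W n q \<longleftrightarrow> (\<forall>b. openin (top_of_set G) (fst (q b)) \<and> E \<inter> fst (q b) \<noteq> {} \<and> snd (q b) \<notin> fst (q b) \<and>
      closed (insert (snd (q b)) (fst (q b))) \<and> insert (snd (q b)) (fst (q b)) \<subseteq> W \<and>
      (\<forall>x\<in>insert (snd (q b)) (fst (q b)). \<forall>y\<in>insert (snd (q b)) (fst (q b)). dist x y \<le> (1/2)^n)) \<and>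
      insert (snd (q True)) (fst (q True)) \<inter> insert (snd (q False)) (fst (q False)) = {}"
    for W and n :: nat and q :: "bool \<Rightarrow> 'a set \<times> 'a"
  have "\<exists>q. good W \<longrightarrow> step W n q" for W n
    using two_cut_point_neighbourhoods[OF assms(1,2) E(2,3) perfect, of W "(1/2)^n"]
    unfolding good_def step_def by auto
  then obtain pick where pick: "\<And>W n. good W \<Longrightarrow> step W n (pick W n)"
    by metis
  \<comment> \<open>The recursion prepends letters, so nodes are indexed by reversed words;
    \<open>undefined\<close> stands in for the boundary point that the root does not have.\<close>
  define node where "node = rec_list (G, undefined) (\<lambda>b r S. pick (fst S) (Suc (length r)) b)"
  have node_simps: "node [] = (G, undefined)" "node (b # r) = pick (fst (node r)) (Suc (length r)) b" for b r
    by (auto simp: node_def)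
  have good: "good (fst (node r))" for r
  proof (induction r)
    case Nil
    then show ?case
      using E by (auto simp: good_def node_simps)
  next
    case (Cons b r)
    from pick[OF this, of "Suc (length r)"] show ?case
      unfolding step_def good_def node_simps by blast
  qed
  define V where "V = (\<lambda>w. fst (node (rev w)))"
  \<comment> \<open>The base point \<open>c []\<close> is taken to be \<open>c [False]\<close>: it
    lies outside \<open>V [False]\<close> as its boundary point and outside \<open>V [True]\<close>
    because siblings are disjoint.\<close>
  define c where "c = (\<lambda>w. snd (node (if w = [] then [False] else rev w)))"
  have V_snoc: "V (w @ [b]) = fst (pick (V w) (Suc (length w)) b)"
    and c_snoc: "c (w @ [b]) = snd (pick (V w) (Suc (length w)) b)" for w b
    by (simp_all add: V_def c_def node_simps)
  have step: "step (V w) (Suc (length w)) (pick (V w) (Suc (length w)))" for w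
    using pick good by (simp add: V_def)
  have c_Nil: "c [] = c [False]"
    by (simp add: c_def)
  have snoc: "c (w @ [b]) \<notin> V (w @ [b])" "closed (insert (c (w @ [b])) (V (w @ [b])))"
    "insert (c (w @ [b])) (V (w @ [b])) \<subseteq> V w"
    "insert (c (w @ [True])) (V (w @ [True])) \<inter> insert (c (w @ [False])) (V (w @ [False])) = {}"
    "\<lbrakk>x \<in> insert (c (w @ [b])) (V (w @ [b])); y \<in> insert (c (w @ [b])) (V (w @ [b]))\<rbrakk> \<Longrightarrow>
      dist x y \<le> (1/2) ^ length (w @ [b])" for w b x y
    using step[of w] unfolding step_def V_snoc c_snoc length_append_singleton by blast+
  have sub: "V w \<subseteq> G" for w
    using good[of "rev w"] by (auto simp: good_def V_def openin_imp_subset dest: openin_imp_subset)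
  have c_in: "c w \<in> G" for w
    using snoc(3)[of "butlast w" "last w"] snoc(3)[of "[]" False] sub c_Nil by (cases "w = []") auto
  have "cut_scheme G V c"
  proof
    show "path_connected G"
      by (rule locally_connected_continuum_imp_path_connected[OF assms(1-3)])
    show "c [] \<notin> V [b]" for b
      using snoc(1,4)[of "[]"] unfolding c_Nil by (cases b) auto
    show "openin (top_of_set G) (V w)" "V w \<noteq> {}" for w
      using good[of "rev w"] by (auto simp: good_def V_def)
    show "closed (insert (c w) (V w))" "c w \<notin> V w" if "w \<noteq> []" for w
      using snoc(1,2)[of "butlast w" "last w"] that by auto
    show "dist x y \<le> (1/2) ^ length w"
      if "w \<noteq> []" "x \<in> insert (c w) (V w)" "y \<in> insert (c w) (V w)" for w x y
      using snoc(5)[of x "butlast w" "last w" y] that by simp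
  qed (use assms(1) c_in snoc(3,4) in \<open>auto simp: V_def node_simps\<close>)
  then show thesis
    by (rule that)
qed

lemma cantor_set_perfect:
  assumes "x \<in> cantor_set" "e > 0"
  shows "\<exists>x'\<in>cantor_set. x' \<noteq> x \<and> dist x x' < e"
proof -
  obtain a :: "nat \<Rightarrow> real" where a: "x = (\<Sum>n. a n / 3 ^ Suc n)" "\<And>n. a n \<in> {0, 2}"
    using assms(1) by (auto simp: cantor_set_def)
  obtain N where N: "(1/3::real)^N < e"
    using real_arch_pow_inv[of e "1/3"] assms(2) by auto
  \<comment> \<open>Exchanging 0 and 2 at place \<open>N\<close> moves the point by
    \<open>2 / 3 ^ Suc N\<close>.\<close>
  define a' where "a' = a(N := 2 - a N)"
  define x' where "x' = (\<Sum>n. a' n / 3 ^ Suc n)"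
  have a': "a' n \<in> {0, 2}" for n
    using a(2)[of n] a(2)[of N] by (auto simp: a'_def)
  then have x': "x' \<in> cantor_set"
    by (auto simp: cantor_set_def x'_def)
  have summable: "summable (\<lambda>n. u n / 3 ^ Suc n)" if "\<And>n. u n \<in> {0, 2}" for u :: "nat \<Rightarrow> real"
  proof (rule summable_comparison_test')
    show "summable (\<lambda>n. (1/3::real)^n)"
      by (simp add: summable_geometric)
    show "norm (u n / 3 ^ Suc n) \<le> (1/3)^n" for n
      using that[of n] by (auto simp: power_divide divide_simps)
  qed
  have "(\<lambda>n. a' n / 3 ^ Suc n - a n / 3 ^ Suc n) sums (x' - x)"
    unfolding x'_def a(1) by (intro sums_diff summable_sums summable a' a(2))
  moreover have "a' n / 3 ^ Suc n - a n / 3 ^ Suc n = (if n = N then (2 - 2 * a N) / 3 ^ Suc N else 0)" for n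
    by (simp add: a'_def diff_divide_distrib)
  ultimately have "(\<lambda>n. if n = N then (2 - 2 * a N) / 3 ^ Suc N else 0) sums (x' - x)"
    by simp
  moreover have "(\<lambda>n. if n = N then (2 - 2 * a N) / 3 ^ Suc N else 0) sums ((2 - 2 * a N) / 3 ^ Suc N)"
    by (rule sums_single)
  ultimately have diff: "x' - x = (2 - 2 * a N) / 3 ^ Suc N"
    by (rule sums_unique2)
  have "x' \<noteq> x"
    using diff a(2)[of N] by auto
  moreover have "\<bar>x' - x\<bar> \<le> (1/3)^N"
    unfolding diff using a(2)[of N] by (auto simp: power_divide field_simps)
  then have "dist x x' < e"
    using N by (simp add: dist_real_def abs_minus_commute)
  ultimately show ?thesis
    using x' by blast
qed

lemma homeomorphic_cantor_set_perfect:
  fixes E :: "'a::metric_space set"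
  assumes "E homeomorphic cantor_set"
  shows "E \<noteq> {}" "\<lbrakk>e \<in> E; r > 0\<rbrakk> \<Longrightarrow> \<exists>e'\<in>E. e' \<noteq> e \<and> dist e e' < r"
proof -
  obtain g h where gh: "homeomorphism cantor_set E g h"
    using assms homeomorphic_sym unfolding homeomorphic_def by blast
  have "(\<Sum>n. (\<lambda>_. 0::real) n / 3 ^ Suc n) \<in> cantor_set"
    unfolding cantor_set_def by (intro CollectI exI[of _ "\<lambda>_. 0"]) auto
  then show "E \<noteq> {}"
    using homeomorphism_image1[OF gh] by blast
  assume e: "e \<in> E" and "r > 0"
  have x: "h e \<in> cantor_set" "g (h e) = e"
    using e gh by (auto simp: homeomorphism_def)
  obtain d where d: "d > 0" "\<And>x'. \<lbrakk>x' \<in> cantor_set; dist x' (h e) < d\<rbrakk> \<Longrightarrow> dist (g x') e < r"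
    using homeomorphism_cont1[OF gh] x \<open>r > 0\<close> unfolding continuous_on_iff by metis
  obtain x' where x': "x' \<in> cantor_set" "x' \<noteq> h e" "dist (h e) x' < d"
    using cantor_set_perfect[OF x(1) d(1)] by blast
  have "g x' \<in> E" "h (g x') = x'"
    using x'(1) gh by (auto simp: homeomorphism_def)
  then show "\<exists>e'\<in>E. e' \<noteq> e \<and> dist e e' < r"
    using x' d(2)[of x'] by (intro bexI[of _ "g x'"]) (auto simp: dist_commute)
qed

section \<open>Ruler sequences\<close>

definition jump :: "(nat \<Rightarrow> bool) \<Rightarrow> nat \<Rightarrow> nat" where
  "jump \<alpha> v = 4 ^ v + of_bool (\<alpha> v)"

text \<open>The gaps between ones follow the ruler function: the gap of valuation \<open>v\<close>
  recurs with period \<open>2 ^ Suc v\<close> in the index of the ones.\<close>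

definition pos :: "(nat \<Rightarrow> bool) \<Rightarrow> nat \<Rightarrow> nat" where
  "pos \<alpha> j = (\<Sum>i<j. jump \<alpha> (multiplicity 2 (Suc i)))"

definition ruler :: "(nat \<Rightarrow> bool) \<Rightarrow> nat \<Rightarrow> bool" where
  "ruler \<alpha> k \<longleftrightarrow> k \<in> range (pos \<alpha>)"

lemma jump_ge: "4 ^ v \<le> jump \<alpha> v"
  by (simp add: jump_def)

lemma jump_pos: "jump \<alpha> v > 0"
  by (simp add: jump_def)

lemma jump_less: "v < v' \<Longrightarrow> jump \<alpha> v < jump \<beta> v'"
proof -
  assume "v < v'"
  then have "4 ^ Suc v \<le> (4::nat) ^ v'"
    by (intro power_increasing) auto
  moreover have "(1::nat) \<le> 4 ^ v"
    by simp
  ultimately have "4 ^ v + 1 < (4::nat) ^ v'"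
    unfolding power_Suc by linarith
  moreover have "jump \<alpha> v \<le> 4 ^ v + 1"
    by (simp add: jump_def)
  ultimately show ?thesis
    using jump_ge[of v' \<beta>] by linarith
qed

text \<open>Since \<open>4 ^ v + 1 < 4 ^ Suc v\<close>, gap lengths of different valuations never
  coincide, whatever the parameters; within one valuation the bit decides the length.\<close>

lemma jump_eq: "jump \<alpha> v = jump \<beta> v' \<Longrightarrow> v = v' \<and> \<alpha> v = \<beta> v"
  using jump_less[of v v' \<alpha> \<beta>] jump_less[of v' v \<beta> \<alpha>] by (cases v v' rule: linorder_cases) (auto simp: jump_def of_bool_def split: if_splits)

lemma pos_Suc: "pos \<alpha> (Suc j) = pos \<alpha> j + jump \<alpha> (multiplicity 2 (Suc j))"
  by (simp add: pos_def)

lemma strict_mono_pos: "strict_mono (pos \<alpha>)"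
  by (simp add: strict_mono_Suc_iff pos_Suc jump_pos)

lemma pos_diff_le: "j \<le> j' \<Longrightarrow> j' - j \<le> pos \<alpha> j' - pos \<alpha> j"
proof (induction j' rule: dec_induct)
  case (step j')
  then show ?case
    using jump_pos[of \<alpha> "multiplicity 2 (Suc j')"] strict_mono_less_eq[OF strict_mono_pos[of \<alpha>], of j j']
    by (simp add: pos_Suc)
qed simp

text \<open>Among \<open>M \<ge> 2 ^ m\<close> consecutive indices one is divisible by \<open>2 ^ m\<close> and contributes a gap of
  length at least \<open>4 ^ m\<close>.\<close>

lemma square_le_pos_diff:
  assumes "j \<le> j'"
  shows "(j' - j)\<^sup>2 \<le> 4 * (pos \<alpha> j' - pos \<alpha> j)"
proof (cases "j = j'")
  case False
  then have "1 \<le> j' - j"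
    using assms by simp
  then obtain m where m: "2 ^ m \<le> j' - j" "j' - j < 2 ^ Suc m"
    using ex_power_ivl1[of 2 "j' - j"] by auto
  \<comment> \<open>The first multiple of \<open>2 ^ m\<close> above \<open>j\<close>; the gap that
    ends there has valuation at least \<open>m\<close>.\<close>
  define q where "q = 2 ^ m * Suc (j div 2 ^ m)"
  have "j mod 2 ^ m < 2 ^ m"
    by simp
  then have "j < q" "q \<le> j + 2 ^ m"
    using mult_div_mod_eq[of "2^m" j] unfolding q_def mult_Suc_right by linarith+
  then obtain i where i: "q = Suc i" "j \<le> i" "i < j'"
    using m(1) by (cases q) auto
  have "m \<le> multiplicity 2 (Suc i)"
    by (rule multiplicity_geI) (auto simp flip: i(1) simp: q_def)
  then have "4 ^ m \<le> jump \<alpha> (multiplicity 2 (Suc i))"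
    by (intro order_trans[OF _ jump_ge] power_increasing) auto
  also have "\<dots> = pos \<alpha> (Suc i) - pos \<alpha> i"
    by (simp add: pos_Suc)
  also have "\<dots> \<le> pos \<alpha> j' - pos \<alpha> j"
    using i strict_mono_less_eq[OF strict_mono_pos[of \<alpha>], of j i]
      strict_mono_less_eq[OF strict_mono_pos[of \<alpha>], of "Suc i" j'] by simp
  finally have "4 ^ m \<le> pos \<alpha> j' - pos \<alpha> j" .
  moreover have "(j' - j)\<^sup>2 \<le> (2 ^ Suc m)\<^sup>2"
    using m(2) by (intro power_mono) auto
  moreover have "((2::nat) ^ Suc m)\<^sup>2 = 4 * 4 ^ m"
    by (simp add: power2_eq_square flip: power_mult_distrib)
  ultimately show ?thesis
    by linarith
qed simp

text \<open>The number of ones is at most one more than the difference of their extreme indices,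
  whence the \<open>- 1\<close>. The bound depends neither on \<open>k\<close> nor on
  \<open>\<alpha>\<close>, so it passes to the whole shift space.\<close>

lemma card_ruler_window: "(card {i. i < n \<and> ruler \<alpha> (k + i)} - 1)\<^sup>2 \<le> 4 * n"
proof -
  define J where "J = {j. k \<le> pos \<alpha> j \<and> pos \<alpha> j < k + n}"
  have "J \<subseteq> {..<k + n}"
    using strict_mono_imp_increasing[OF strict_mono_pos[of \<alpha>]] by (auto simp: J_def intro: le_less_trans)
  then have fin: "finite J"
    using finite_subset by blast
  have "{i. i < n \<and> ruler \<alpha> (k + i)} \<subseteq> (\<lambda>j. pos \<alpha> j - k) ` J"
  proof
    fix i assume "i \<in> {i. i < n \<and> ruler \<alpha> (k + i)}"
    then obtain j where "i < n" "k + i = pos \<alpha> j"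
      by (auto simp: ruler_def)
    then show "i \<in> (\<lambda>j. pos \<alpha> j - k) ` J"
      by (intro image_eqI[of _ _ j]) (auto simp: J_def)
  qed
  then have card: "card {i. i < n \<and> ruler \<alpha> (k + i)} \<le> card J"
    using fin by (meson card_image_le card_mono finite_imageI le_trans)
  show ?thesis
  proof (cases "J = {}")
    case False
    define a b where "a = Min J" and "b = Max J"
    have ab: "a \<in> J" "b \<in> J" "a \<le> b"
      using fin False by (auto simp: a_def b_def)
    have "J \<subseteq> {a..b}"
      using fin by (auto simp: a_def b_def)
    then have "card J \<le> Suc b - a"
      using card_mono[of "{a..b}" J] by simp
    then have "(card {i. i < n \<and> ruler \<alpha> (k + i)} - 1)\<^sup>2 \<le> (b - a)\<^sup>2"
      using card by (intro power_mono) auto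
    also have "\<dots> \<le> 4 * (pos \<alpha> b - pos \<alpha> a)"
      by (rule square_le_pos_diff[OF ab(3)])
    also have "\<dots> \<le> 4 * n"
      using ab by (auto simp: J_def)
    finally show ?thesis .
  next
    case True
    then have "card {i. i < n \<and> ruler \<alpha> (k + i)} = 0"
      using card by simp
    then show ?thesis
      by (metis diff_0_eq_0 zero_power2 zero_le)
  qed
qed

text \<open>All parameters share one language, so that a single map carries the orbits of all ruler
  sequences.\<close>

definition lang :: "bool list set" where
  "lang = {map (ruler \<alpha>) [k..<k + n] |\<alpha> k n. True}"

lemma Nil_lang: "[] \<in> lang"
  by (auto simp: lang_def intro!: exI[of _ 0])

lemma tl_lang: "w \<in> lang \<Longrightarrow> tl w \<in> lang"
proof -
  assume "w \<in> lang"
  then obtain \<alpha> k n where w: "w = map (ruler \<alpha>) [k..<k + n]"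
    by (auto simp: lang_def)
  have "tl w = map (ruler \<alpha>) [Suc k..<Suc k + (n - 1)]"
    by (cases n) (auto simp: w map_tl[symmetric] upt_rec[of k] simp del: upt_Suc)
  then show ?thesis
    unfolding lang_def by blast
qed

lemma butlast_lang: "w \<in> lang \<Longrightarrow> butlast w \<in> lang"
proof -
  assume "w \<in> lang"
  then obtain \<alpha> k n where w: "w = map (ruler \<alpha>) [k..<k + n]"
    by (auto simp: lang_def)
  have "butlast w = map (ruler \<alpha>) [k..<k + (n - 1)]"
    by (cases n) (auto simp: w)
  then show ?thesis
    unfolding lang_def by blast
qed

lemma pref_in_lang: "(\<And>i. i < n \<Longrightarrow> s i = ruler \<alpha> (k + i)) \<Longrightarrow> pref s n \<in> lang"
proof -
  assume "\<And>i. i < n \<Longrightarrow> s i = ruler \<alpha> (k + i)"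
  then have "pref s n = map (ruler \<alpha>) [k..<k + n]"
    by (intro nth_equalityI) (auto simp: pref_def)
  then show ?thesis
    unfolding lang_def by blast
qed

lemma ruler_in_shift_space: "ruler \<alpha> \<in> shift_space lang"
  unfolding shift_space_def using pref_in_lang[of _ "ruler \<alpha>" \<alpha> 0] by auto

lemma card_ones:
  assumes "s \<in> shift_space lang"
  shows "(card {i. i < n \<and> s i} - 1)\<^sup>2 \<le> 4 * n"
proof -
  have "pref s n \<in> lang"
    using assms by (simp add: shift_space_def)
  then obtain \<alpha> k m where m: "pref s n = map (ruler \<alpha>) [k..<k + m]"
    by (auto simp: lang_def)
  then have "m = n"
    by (metis add_diff_cancel_left' length_map length_pref length_upt)
  have "s i = ruler \<alpha> (k + i)" if "i < n" for i
    using arg_cong[OF m, of "\<lambda>w. w ! i"] that \<open>m = n\<close> by (simp add: pref_def)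
  then have "{i. i < n \<and> s i} = {i. i < n \<and> ruler \<alpha> (k + i)}"
    by auto
  then show ?thesis
    using card_ruler_window by simp
qed

lemma not_periodic:
  assumes "s \<in> shift_space lang" "s 0" "n > 0"
  shows "\<exists>i. s (i + n) \<noteq> s i"
proof (rule ccontr)
  assume "\<not> ?thesis"
  then have per: "s (i + n) = s i" for i
    by auto
  have s: "s (m * n)" for m
  proof (induction m)
    case (Suc m)
    then show ?case
      using per[of "m * n"] by (simp add: add.commute)
  qed (use assms(2) in simp)
  \<comment> \<open>\<open>K + 1\<close> ones at multiples of \<open>n\<close> in a window of length
    \<open>K * n + 1\<close> force \<open>K * K \<le> 4 * (K * n + 1)\<close>, which fails for this
    \<open>K\<close>.\<close>
  define K where "K = 4 * n + 4"
  have "(\<lambda>m. m * n) ` {..K} \<subseteq> {i. i < K * n + 1 \<and> s i}"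
    using s by (auto simp: less_Suc_eq_le)
  then have "card ((\<lambda>m. m * n) ` {..K}) \<le> card {i. i < K * n + 1 \<and> s i}"
    by (intro card_mono) auto
  moreover have "inj_on (\<lambda>m. m * n) {..K}"
    using assms(3) by (auto simp: inj_on_def)
  ultimately have "K \<le> card {i. i < K * n + 1 \<and> s i} - 1"
    by (simp add: card_image)
  then have "K\<^sup>2 \<le> 4 * (K * n + 1)"
    using card_ones[OF assms(1), of "K * n + 1"] power_mono[of K _ 2] by (meson le_trans zero_le)
  then show False
    by (simp add: K_def power2_eq_square algebra_simps)
qed

text \<open>The gap after the one of index \<open>2 ^ n - 1\<close> has valuation \<open>n\<close>,
  hence length at least \<open>4 ^ n\<close>, and holds \<open>n\<close> zeros. This supplies a
  common point of all the omega-limit sets.\<close>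

lemma zero_in_ruler_limit: "\<exists>k\<ge>n. \<forall>i<n. \<not> ruler \<alpha> (k + i)"
proof (intro exI[of _ "Suc (pos \<alpha> (2 ^ n - 1))"] conjI allI impI)
  have "n \<le> 2 ^ n - 1"
    using less_exp[of n] by linarith
  also have "\<dots> \<le> pos \<alpha> (2 ^ n - 1)"
    by (rule strict_mono_imp_increasing[OF strict_mono_pos])
  finally show "n \<le> Suc (pos \<alpha> (2 ^ n - 1))"
    by simp
  fix i assume "i < n"
  show "\<not> ruler \<alpha> (Suc (pos \<alpha> (2 ^ n - 1)) + i)"
  proof
    assume "ruler \<alpha> (Suc (pos \<alpha> (2 ^ n - 1)) + i)"
    then obtain j where j: "pos \<alpha> j = Suc (pos \<alpha> (2 ^ n - 1)) + i"
      by (auto simp: ruler_def)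
    then have "pos \<alpha> (2 ^ n - 1) < pos \<alpha> j"
      by simp
    then have "2 ^ n - 1 < j"
      using strict_mono_less[OF strict_mono_pos] by blast
    then have "Suc (2 ^ n - 1) \<le> j"
      by simp
    then have "pos \<alpha> (Suc (2 ^ n - 1)) \<le> pos \<alpha> j"
      using strict_mono_less_eq[OF strict_mono_pos] by blast
    moreover have "multiplicity 2 (Suc (2 ^ n - 1)) = n"
      by (simp add: multiplicity_same_power)
    ultimately have "pos \<alpha> (2 ^ n - 1) + 4 ^ n \<le> pos \<alpha> j"
      using jump_ge[of n \<alpha>] unfolding pos_Suc by simp
    moreover have "n < (4::nat) ^ n"
      using less_exp[of n] power_mono[of 2 "4::nat" n] by linarith
    ultimately show False
      using j \<open>i < n\<close> by linarith
  qed
qed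

section \<open>The limit points of ruler sequences\<close>

lemma multiplicity_add_high_power:
  assumes "0 < u" "u < 4 ^ m"
  shows "multiplicity 2 (u + 4 ^ m * q) = multiplicity 2 (u :: nat)"
proof (rule multiplicity_eqI)
  define v where "v = multiplicity 2 u"
  have dvd: "2 ^ v dvd u" "\<not> 2 ^ Suc v dvd u"
    using assms(1) by (auto simp: v_def multiplicity_dvd power_dvd_iff_le_multiplicity simp del: power_Suc)
  have "(2::nat) ^ v \<le> u"
    using dvd(1) assms(1) by (rule dvd_imp_le)
  also have "u < 2 ^ (2 * m)"
    using assms(2) by (simp add: power_mult)
  finally have "v < 2 * m"
    by simp
  then have "(2::nat) ^ Suc v dvd 2 ^ (2 * m)"
    by (intro le_imp_power_dvd) simp
  then have *: "(2::nat) ^ Suc v dvd 4 ^ m * q"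
    by (simp add: power_mult del: power_Suc)
  then have "2 ^ v dvd 4 ^ m * q"
    by (metis dvd_trans le_imp_power_dvd le_SucI order_refl)
  with * dvd show "2 ^ multiplicity 2 u dvd u + 4 ^ m * q" "\<not> 2 ^ Suc (multiplicity 2 u) dvd u + 4 ^ m * q"
    unfolding v_def[symmetric] by (auto simp: dvd_add_left_iff simp del: power_Suc)
qed

text \<open>The limit points of the orbit of \<open>ruler \<alpha>\<close> are indexed by 2-adic integers \<open>\<Sum>k. b k * 4 ^ k\<close>,
  whose partial sums are the values of \<open>adic\<close>; \<open>lpos\<close> lists the positions of the ones.\<close>

definition adic :: "(nat \<Rightarrow> bool) \<Rightarrow> nat \<Rightarrow> nat" where
  "adic b n = (\<Sum>k<n. of_bool (b k) * 4 ^ k)"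

definition lpos :: "(nat \<Rightarrow> bool) \<Rightarrow> (nat \<Rightarrow> bool) \<Rightarrow> nat \<Rightarrow> nat" where
  "lpos \<alpha> b j = (\<Sum>i<j. jump \<alpha> (multiplicity 2 (adic b (Suc i) + Suc i)))"

definition ruler_limit :: "(nat \<Rightarrow> bool) \<Rightarrow> (nat \<Rightarrow> bool) \<Rightarrow> nat \<Rightarrow> bool" where
  "ruler_limit \<alpha> b k \<longleftrightarrow> k \<in> range (lpos \<alpha> b)"

lemma lpos_Suc: "lpos \<alpha> b (Suc j) = lpos \<alpha> b j + jump \<alpha> (multiplicity 2 (adic b (Suc j) + Suc j))"
  by (simp add: lpos_def)

lemma lpos_0 [simp]: "lpos \<alpha> b 0 = 0"
  by (simp add: lpos_def)

lemma strict_mono_lpos: "strict_mono (lpos \<alpha> b)"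
  by (simp add: strict_mono_Suc_iff lpos_Suc jump_pos)

text \<open>Digits 0 and 1 in base 4 leave room for \<open>Suc i\<close>: the number
  \<open>adic b (Suc i) + Suc i\<close> is positive and below \<open>4 ^ Suc i\<close>, so higher
  digits do not change its valuation.\<close>

lemma adic_less: "3 * adic b n < 4 ^ n"
  by (induction n) (auto simp: adic_def)

lemma adic_split: "n \<le> m \<Longrightarrow> \<exists>q. adic b m = adic b n + 4 ^ n * q"
proof (induction m rule: dec_induct)
  case base
  show ?case
    by (intro exI[of _ 0]) simp
next
  case (step m)
  then obtain q where "adic b m = adic b n + 4 ^ n * q"
    by blast
  moreover have "(4::nat) ^ m = 4 ^ n * 4 ^ (m - n)"
    using step by (simp flip: power_add)
  ultimately have "adic b (Suc m) = adic b n + 4 ^ n * (q + of_bool (b m) * 4 ^ (m - n))"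
    by (simp add: adic_def algebra_simps)
  then show ?case ..
qed

lemma double_le_four_power: "2 * Suc n \<le> 4 ^ Suc n"
  by (induction n) auto

text \<open>The digits from place \<open>Suc i\<close> on and the leading \<open>4 ^ n\<close>
  contribute multiples of \<open>4 ^ Suc i\<close>, too high to matter.\<close>

lemma multiplicity_adic:
  assumes "i < n"
  shows "multiplicity 2 (4 ^ n + adic b n + Suc i) = multiplicity 2 (adic b (Suc i) + Suc i)"
proof -
  obtain q where "adic b n = adic b (Suc i) + 4 ^ Suc i * q"
    using adic_split[of "Suc i" n] assms by auto
  moreover have "(4::nat) ^ n = 4 ^ Suc i * 4 ^ (n - Suc i)"
    using assms by (simp flip: power_add power_Suc)
  ultimately have "4 ^ n + adic b n + Suc i = (adic b (Suc i) + Suc i) + 4 ^ Suc i * (q + 4 ^ (n - Suc i))"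
    by (simp only: distrib_left ac_simps)
  moreover have "x + y < z" if "3 * x < z" "2 * y \<le> z" for x y z :: nat
    using that by linarith
  from this[OF adic_less double_le_four_power] have "adic b (Suc i) + Suc i < 4 ^ Suc i" .
  ultimately show ?thesis
    using multiplicity_add_high_power[of "adic b (Suc i) + Suc i" "Suc i"] by (metis zero_less_Suc add_gr_0)
qed

lemma pos_adic: "i \<le> n \<Longrightarrow> pos \<alpha> (4 ^ n + adic b n + i) = pos \<alpha> (4 ^ n + adic b n) + lpos \<alpha> b i"
  by (induction i) (use multiplicity_adic in \<open>auto simp: pos_Suc lpos_Suc\<close>)

text \<open>The window starts at the one of index \<open>4 ^ n + adic b n\<close>: the partial sum
  approximates the 2-adic integer, and the power of 4 moves the window out to position
  \<open>n\<close> or beyond without affecting the gaps.\<close>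

lemma ruler_limit_occurs: "\<exists>k\<ge>n. \<forall>i<n. ruler \<alpha> (k + i) = ruler_limit \<alpha> b i"
proof -
  define T where "T = 4 ^ n + adic b n"
  have "n \<le> 4 ^ n"
    using less_exp[of n] power_mono[of 2 "4::nat" n] by linarith
  then have "n \<le> T"
    unfolding T_def by linarith
  also have "T \<le> pos \<alpha> T"
    by (rule strict_mono_imp_increasing[OF strict_mono_pos])
  finally have "n \<le> pos \<alpha> T" .
  moreover have "ruler \<alpha> (pos \<alpha> T + i) = ruler_limit \<alpha> b i" if "i < n" for i
  proof
    assume "ruler \<alpha> (pos \<alpha> T + i)"
    then obtain j where j: "pos \<alpha> j = pos \<alpha> T + i"
      by (auto simp: ruler_def)
    then have "T \<le> j"
      using strict_mono_less_eq[OF strict_mono_pos[of \<alpha>], of T j] by simp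
    moreover have "j - T \<le> n"
      using pos_diff_le[OF \<open>T \<le> j\<close>, of \<alpha>] j that by simp
    ultimately have "pos \<alpha> j = pos \<alpha> T + lpos \<alpha> b (j - T)"
      using pos_adic[of "j - T" n \<alpha> b] by (simp add: T_def)
    then show "ruler_limit \<alpha> b i"
      using j by (auto simp: ruler_limit_def)
  next
    assume "ruler_limit \<alpha> b i"
    then obtain j where j: "i = lpos \<alpha> b j"
      by (auto simp: ruler_limit_def)
    moreover have "j \<le> n"
      using strict_mono_imp_increasing[OF strict_mono_lpos[of \<alpha> b], of j] j that by simp
    ultimately have "pos \<alpha> T + i = pos \<alpha> (T + j)"
      using pos_adic[of j n \<alpha> b] by (simp add: T_def)
    then show "ruler \<alpha> (pos \<alpha> T + i)"
      by (auto simp: ruler_def)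
  qed
  ultimately show ?thesis
    by blast
qed

lemma ruler_limit_in_shift_space: "ruler_limit \<alpha> b \<in> shift_space lang"
proof -
  have "pref (ruler_limit \<alpha> b) n \<in> lang" for n
    using ruler_limit_occurs[of n \<alpha> b] pref_in_lang[of n "ruler_limit \<alpha> b" \<alpha>] by metis
  then show ?thesis
    by (simp add: shift_space_def)
qed

lemma ruler_limit_0: "ruler_limit \<alpha> b 0"
  unfolding ruler_limit_def by (intro image_eqI[of _ _ 0]) auto

text \<open>Serves to compare gaps: two sequences that agree on a stretch from a common one to the
  next have the same gap there.\<close>

lemma next_element_eq:
  fixes g h :: "nat \<Rightarrow> nat"
  assumes "strict_mono g" "strict_mono h" "g i = h j"
    and ran: "\<And>x. \<lbrakk>g i < x; x \<le> g (Suc i)\<rbrakk> \<Longrightarrow> x \<in> range g \<longleftrightarrow> x \<in> range h"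
  shows "g (Suc i) = h (Suc j)"
proof (rule antisym)
  have "g i < g (Suc i)"
    using assms(1) by (simp add: strict_mono_def)
  then obtain j' where j': "g (Suc i) = h j'"
    using ran[of "g (Suc i)"] by auto
  then have "j < j'"
    using \<open>g i < g (Suc i)\<close> assms(3) strict_mono_less[OF assms(2)] by simp
  then show le: "h (Suc j) \<le> g (Suc i)"
    using j' strict_mono_less_eq[OF assms(2)] by simp
  have "g i < h (Suc j)"
    using assms(2,3) by (simp add: strict_mono_def)
  then obtain i' where i': "h (Suc j) = g i'"
    using ran[of "h (Suc j)"] le by auto
  then have "i < i'"
    using \<open>g i < h (Suc j)\<close> strict_mono_less[OF assms(1)] by simp
  then show "g (Suc i) \<le> h (Suc j)"
    using i' strict_mono_less_eq[OF assms(1)] by simp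
qed

text \<open>Steers the translated index to the residue \<open>e\<close> modulo \<open>4 ^ m\<close>.
  The summand \<open>4 ^ m\<close> avoids truncated subtraction and makes
  \<open>m \<le> Suc i\<close>, so that \<open>adic_split\<close> applies to every digit
  sequence.\<close>

lemma adic_hit:
  obtains i where "m \<le> Suc i" "adic b m + Suc i = 4 ^ m + e"
    "\<And>b'. \<exists>q. adic b' (Suc i) = adic b' m + 4 ^ m * q"
proof -
  define i where "i = 4 ^ m + e - adic b m - 1"
  have "3 * m \<le> 2 * 4 ^ m"
    using double_le_four_power[of "m - 1"] by (cases m) auto
  then have "m \<le> Suc i" "adic b m + Suc i = 4 ^ m + e"
    using adic_less[of b m] by (simp_all add: i_def)
  then show thesis
    using that[of i] adic_split[of m "Suc i"] by blast
qed

text \<open>Every valuation \<open>v\<close> occurs in the limit sequence, with a gap of length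
  \<open>jump \<alpha> v\<close>. A ruler sequence that contains a long enough prefix has the same
  gap between consecutive ones, and \<open>jump_eq\<close> compares the bits.\<close>

lemma ruler_limit_separates:
  assumes "\<And>n. \<exists>k. \<forall>i<n. ruler \<beta> (k + i) = ruler_limit \<alpha> b i"
  shows "\<alpha> = \<beta>"
proof
  fix v
  \<comment> \<open>The residue \<open>2 ^ v\<close> modulo \<open>4 ^ Suc v\<close> has valuation
    exactly \<open>v\<close>.\<close>
  obtain i where i: "adic b (Suc v) + Suc i = 4 ^ Suc v + 2 ^ v"
      "\<And>b'. \<exists>q. adic b' (Suc i) = adic b' (Suc v) + 4 ^ Suc v * q"
    using adic_hit[of "Suc v" b "2 ^ v"] by metis
  obtain q where "adic b (Suc i) = adic b (Suc v) + 4 ^ Suc v * q"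
    using i(2) by blast
  then have "adic b (Suc i) + Suc i = 2 ^ v + 4 ^ Suc v * Suc q"
    using i(1) by simp
  moreover have "(2::nat) ^ v < 4 ^ Suc v"
    using power_mono[of 2 "4::nat" v] zero_less_power[of "4::nat" v] unfolding power_Suc by linarith
  ultimately have mult: "multiplicity 2 (adic b (Suc i) + Suc i) = v"
    using multiplicity_add_high_power[of "2 ^ v" "Suc v" "Suc q"] by (simp add: multiplicity_same_power)
  obtain k where k: "\<forall>y<Suc (lpos \<alpha> b (Suc i)). ruler \<beta> (k + y) = ruler_limit \<alpha> b y"
    using assms by blast
  have less: "lpos \<alpha> b i < lpos \<alpha> b (Suc i)"
    using strict_mono_lpos by (simp add: strict_mono_def)
  then have "ruler \<beta> (k + lpos \<alpha> b i)"
    using k by (simp add: ruler_limit_def)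
  then obtain j where j: "k + lpos \<alpha> b i = pos \<beta> j"
    by (auto simp: ruler_def)
  have "k + lpos \<alpha> b (Suc i) = pos \<beta> (Suc j)"
  proof (rule next_element_eq)
    show "strict_mono (\<lambda>j. k + lpos \<alpha> b j)"
      using strict_mono_lpos by (simp add: strict_mono_def)
    fix x assume x: "k + lpos \<alpha> b i < x" "x \<le> k + lpos \<alpha> b (Suc i)"
    then obtain y where y: "x = k + y"
      using le_Suc_ex[of k x] by auto
    have "x \<in> range (\<lambda>j. k + lpos \<alpha> b j) \<longleftrightarrow> ruler_limit \<alpha> b y"
      by (auto simp: y ruler_limit_def)
    also have "\<dots> \<longleftrightarrow> x \<in> range (pos \<beta>)"
      using k x(2) by (simp add: y ruler_def)
    finally show "x \<in> range (\<lambda>j. k + lpos \<alpha> b j) \<longleftrightarrow> x \<in> range (pos \<beta>)" .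
  qed (use j strict_mono_pos in auto)
  then have "jump \<alpha> v = jump \<beta> (multiplicity 2 (Suc j))"
    using j mult by (simp add: lpos_Suc pos_Suc)
  then show "\<alpha> v = \<beta> v"
    using jump_eq by metis
qed

text \<open>The index is steered to residue 0 modulo \<open>4 ^ Suc k\<close> for \<open>b'\<close>,
  of valuation at least \<open>2 * k + 2\<close>; for \<open>b\<close> the residue is then
  \<open>4 ^ k\<close>, of valuation \<open>2 * k\<close>.\<close>

lemma adic_multiplicity_differs:
  assumes "\<And>k'. k' < k \<Longrightarrow> b k' = b' k'" "b k" "\<not> b' k"
  shows "\<exists>i. multiplicity 2 (adic b (Suc i) + Suc i) \<noteq> multiplicity 2 (adic b' (Suc i) + Suc i)"
proof -
  obtain i where i: "adic b' (Suc k) + Suc i = 4 ^ Suc k + 0"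
      "\<And>b'. \<exists>q. adic b' (Suc i) = adic b' (Suc k) + 4 ^ Suc k * q"
    using adic_hit[of "Suc k" b' 0] by metis
  obtain q q' where q: "adic b (Suc i) = adic b (Suc k) + 4 ^ Suc k * q"
      "adic b' (Suc i) = adic b' (Suc k) + 4 ^ Suc k * q'"
    using i(2) by metis
  have "adic b k = adic b' k"
    using assms(1) unfolding adic_def by (intro sum.cong) auto
  then have "adic b (Suc k) = adic b' (Suc k) + 4 ^ k"
    using assms(2,3) by (simp add: adic_def)
  then have "adic b (Suc i) + Suc i = 4 ^ k + 4 ^ Suc k * Suc q"
    using q(1) i(1) by simp
  then have "multiplicity 2 (adic b (Suc i) + Suc i) = multiplicity (2::nat) (4 ^ k)"
    using multiplicity_add_high_power[of "4 ^ k" "Suc k" "Suc q"] by simp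
  also have "(4::nat) ^ k = 2 ^ (2 * k)"
    by (simp add: power_mult)
  finally have "multiplicity 2 (adic b (Suc i) + Suc i) = 2 * k"
    by (simp add: multiplicity_same_power)
  moreover have "adic b' (Suc i) + Suc i = 2 ^ (2 * Suc k) * Suc q'"
    unfolding power_mult using q(2) i(1) by simp
  then have "2 * Suc k \<le> multiplicity 2 (adic b' (Suc i) + Suc i)"
    by (intro multiplicity_geI) (simp_all only: dvd_triv_left, auto)
  ultimately show ?thesis
    by (intro exI[of _ i]) simp
qed

text \<open>Equal sequences have the same gaps, hence the same valuations, against
  \<open>adic_multiplicity_differs\<close> at the first different digit.\<close>

lemma inj_ruler_limit: "inj (ruler_limit \<alpha>)"
proof (rule injI, rule ccontr)
  fix b b' assume eq: "ruler_limit \<alpha> b = ruler_limit \<alpha> b'" and "b \<noteq> b'"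
  have ran: "x \<in> range (lpos \<alpha> b) \<longleftrightarrow> x \<in> range (lpos \<alpha> b')" for x
    using fun_cong[OF eq, of x] by (simp add: ruler_limit_def)
  have lpos: "lpos \<alpha> b i = lpos \<alpha> b' i" for i
  proof (induction i)
    case (Suc i)
    show ?case
      by (rule next_element_eq[OF strict_mono_lpos strict_mono_lpos Suc ran])
  qed simp
  have mult: "multiplicity 2 (adic b (Suc i) + Suc i) = multiplicity 2 (adic b' (Suc i) + Suc i)" for i
    using lpos[of "Suc i"] lpos[of i] jump_eq unfolding lpos_Suc by (metis add_left_cancel)
  define k where "k = (LEAST k. b k \<noteq> b' k)"
  have "b k \<noteq> b' k"
    using LeastI_ex[of "\<lambda>k. b k \<noteq> b' k"] \<open>b \<noteq> b'\<close> by (auto simp: k_def)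
  moreover have "b k' = b' k'" if "k' < k" for k'
    using not_less_Least[of k' "\<lambda>k. b k \<noteq> b' k"] that by (simp add: k_def)
  ultimately show False
    using adic_multiplicity_differs[of k b b'] adic_multiplicity_differs[of k b' b] mult by metis
qed

section \<open>Dynamics of the extended map\<close>

text \<open>Statistical convergence of the orbit, stated by frequencies for each distance
  \<open>t\<close>, the form in which it can be compared with \<open>prox_freq\<close>.\<close>

definition attracted :: "('a::metric_space \<Rightarrow> 'a) \<Rightarrow> 'a \<Rightarrow> 'a \<Rightarrow> bool" where
  "attracted f x p \<longleftrightarrow>
     (\<forall>t>0. (\<lambda>n. real (card {i. i < n \<and> t \<le> dist ((f ^^ i) x) p}) / real n) \<longlonglongrightarrow> 0)"

text \<open>For a pair attracted to \<open>p\<close> and \<open>q\<close> the two distribution functions can differ only at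
  \<open>t = dist p q\<close>.\<close>

lemma attracted_imp_not_DC3_pair:
  assumes x: "attracted f x p" and y: "attracted f y q"
  shows "\<not> DC3_pair X f x y"
proof
  define bad where "bad = (\<lambda>t n. real (card {i. i < n \<and> t \<le> dist ((f ^^ i) x) p}) / real n +
      real (card {i. i < n \<and> t \<le> dist ((f ^^ i) y) q}) / real n)"
  have bad: "bad t \<longlonglongrightarrow> 0" if "t > 0" for t
    using tendsto_add[OF x[unfolded attracted_def, rule_format, OF that] y[unfolded attracted_def, rule_format, OF that]]
    by (simp add: bad_def)
  have bad_ge: "real (card A) / real n \<le> bad t n"
    if "A \<subseteq> {i. i < n \<and> t \<le> dist ((f ^^ i) x) p} \<union> {i. i < n \<and> t \<le> dist ((f ^^ i) y) q}" for A t n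
  proof -
    have "card A \<le> card {i. i < n \<and> t \<le> dist ((f ^^ i) x) p} + card {i. i < n \<and> t \<le> dist ((f ^^ i) y) q}"
      by (rule order_trans[OF card_mono[OF _ that] card_Un_le]) auto
    then have "real (card A) / real n \<le> (real (card {i. i < n \<and> t \<le> dist ((f ^^ i) x) p}) +
        real (card {i. i < n \<and> t \<le> dist ((f ^^ i) y) q})) / real n"
      by (intro divide_right_mono) auto
    then show ?thesis
      by (simp add: bad_def add_divide_distrib)
  qed
  have lim: "\<exists>l. (\<lambda>n. prox_freq f x y n t) \<longlonglongrightarrow> l" if t: "t \<noteq> dist p q" for t
  proof (cases "t < dist p q")
    case True
    \<comment> \<open>If both orbits are closer than \<open>e\<close> to their attractors, their
      mutual distance exceeds \<open>t\<close>.\<close>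
    define e where "e = (dist p q - t) / 2"
    have "e > 0"
      using True by (simp add: e_def)
    have "prox_freq f x y n t \<le> bad e n" for n
      unfolding prox_freq_def
    proof (rule bad_ge, rule subsetI)
      fix i assume i: "i \<in> {i. i < n \<and> dist ((f ^^ i) x) ((f ^^ i) y) < t}"
      have "dist p q \<le> dist ((f ^^ i) x) p + dist ((f ^^ i) x) ((f ^^ i) y) + dist ((f ^^ i) y) q"
        using dist_triangle3[of p q "(f ^^ i) x"] dist_triangle[of "(f ^^ i) x" q "(f ^^ i) y"] by linarith
      then show "i \<in> {i. i < n \<and> e \<le> dist ((f ^^ i) x) p} \<union> {i. i < n \<and> e \<le> dist ((f ^^ i) y) q}"
        using i by (auto simp: e_def field_simps)
    qed
    then have "(\<lambda>n. prox_freq f x y n t) \<longlonglongrightarrow> 0"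
      by (intro tendsto_sandwich[OF _ _ tendsto_const bad[OF \<open>e > 0\<close>]] always_eventually allI)
        (auto simp: prox_freq_def)
    then show ?thesis ..
  next
    case False
    define e where "e = (t - dist p q) / 2"
    have "e > 0"
      using False t by (simp add: e_def)
    have "1 - bad e n \<le> prox_freq f x y n t" if "n > 0" for n
    proof -
      define A where "A = {i. i < n \<and> dist ((f ^^ i) x) ((f ^^ i) y) < t}"
      have "real (card ({..<n} - A)) / real n \<le> bad e n"
      proof (rule bad_ge, rule subsetI)
        fix i assume i: "i \<in> {..<n} - A"
        have "dist ((f ^^ i) x) ((f ^^ i) y) \<le> dist ((f ^^ i) x) p + dist p q + dist ((f ^^ i) y) q"
          using dist_triangle[of "(f ^^ i) x" "(f ^^ i) y" p] dist_triangle2[of p "(f ^^ i) y" q] by linarith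
        then show "i \<in> {i. i < n \<and> e \<le> dist ((f ^^ i) x) p} \<union> {i. i < n \<and> e \<le> dist ((f ^^ i) y) q}"
          using i by (auto simp: e_def A_def field_simps)
      qed
      moreover have "real (card ({..<n} - A)) = real n - real (card A)"
      proof -
        have "A \<subseteq> {..<n}"
          by (auto simp: A_def)
        then show ?thesis
          using card_mono[of "{..<n}" A] finite_subset[of A "{..<n}"] by (simp add: card_Diff_subset of_nat_diff)
      qed
      ultimately show ?thesis
        using that by (simp add: prox_freq_def A_def diff_divide_distrib)
    qed
    then have lower: "eventually (\<lambda>n. 1 - bad e n \<le> prox_freq f x y n t) sequentially"
      by (intro eventually_sequentiallyI[of 1]) auto
    have upper: "prox_freq f x y n t \<le> 1" for n
    proof -
      have "card {i. i < n \<and> dist ((f ^^ i) x) ((f ^^ i) y) < t} \<le> card {..<n}"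
        by (intro card_mono) auto
      then show ?thesis
        by (cases "n = 0") (simp_all add: prox_freq_def divide_le_eq_1)
    qed
    have "(\<lambda>n. 1 - bad e n) \<longlonglongrightarrow> 1"
      using tendsto_diff[OF tendsto_const[of 1] bad[OF \<open>e > 0\<close>]] by simp
    then have "(\<lambda>n. prox_freq f x y n t) \<longlonglongrightarrow> 1"
      by (rule tendsto_sandwich[OF lower always_eventually[OF allI[OF upper]] _ tendsto_const])
    then show ?thesis ..
  qed
  have eq: "upper_dist_fun X f x y t = lower_dist_fun X f x y t" if t: "t \<noteq> dist p q" for t
  proof -
    obtain l where "(\<lambda>n. prox_freq f x y n t) \<longlonglongrightarrow> l"
      using lim[OF t] by blast
    then have l: "(\<lambda>n. ereal (prox_freq f x y n t)) \<longlonglongrightarrow> ereal l"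
      by (rule tendsto_ereal)
    show ?thesis
      unfolding upper_dist_fun_def lower_dist_fun_def
        lim_imp_Liminf[OF sequentially_bot l] lim_imp_Limsup[OF sequentially_bot l] ..
  qed
  assume "DC3_pair X f x y"
  then obtain a b where ab: "a < b" "\<And>t. t \<in> {a<..<b} \<Longrightarrow> upper_dist_fun X f x y t > lower_dist_fun X f x y t"
    unfolding DC3_pair_def by blast
  obtain t where t: "a < t" "t < b"
    using dense[OF ab(1)] by blast
  \<comment> \<open>Two different thresholds in the interval would both have to equal
    \<open>dist p q\<close>.\<close>
  obtain t' where t': "a < t'" "t' < t"
    using dense[OF t(1)] by blast
  have unique: "r = dist p q" if "a < r" "r < b" for r
    using ab(2)[of r] eq[of r] that by (cases "r = dist p q") auto
  show False
    using unique[OF t] unique[of t'] t t' by simp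
qed

lemma eventually_fixed_imp_attracted:
  assumes "(f ^^ N) x = p" "f p = p"
  shows "attracted f x p"
  unfolding attracted_def
proof (intro allI impI)
  fix t :: real assume "t > 0"
  have fix_p: "(f ^^ k) p = p" for k
    by (induction k) (auto simp: assms(2))
  have "(f ^^ i) x = p" if "i \<ge> N" for i
    using funpow_add[of "i - N" N f] that fix_p assms(1) by simp
  then have "{i. i < n \<and> t \<le> dist ((f ^^ i) x) p} \<subseteq> {..<N}" for n
    using \<open>t > 0\<close> by (auto simp: not_le[symmetric])
  then have "card {i. i < n \<and> t \<le> dist ((f ^^ i) x) p} \<le> N" for n
    using card_mono[of "{..<N}"] by fastforce
  then have le: "real (card {i. i < n \<and> t \<le> dist ((f ^^ i) x) p}) / real n \<le> real N / real n" for n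
    by (intro divide_right_mono) auto
  show "(\<lambda>n. real (card {i. i < n \<and> t \<le> dist ((f ^^ i) x) p}) / real n) \<longlonglongrightarrow> 0"
    by (rule tendsto_sandwich[OF _ always_eventually[OF allI[OF le]] tendsto_const lim_const_over_n]) simp
qed

section \<open>Criteria for omega-limit points\<close>

lemma omega_limitI:
  fixes f :: "'a::metric_space \<Rightarrow> 'a"
  assumes "\<And>e N. e > 0 \<Longrightarrow> \<exists>n\<ge>N. dist ((f ^^ n) x) y < e"
  shows "y \<in> omega_limit f x"
proof -
  have "\<exists>k. \<forall>n. dist ((f ^^ k n) x) y < 1 / real (Suc n) \<and> k n < k (Suc n)"
  proof (rule dependent_nat_choice)
    show "\<exists>k. dist ((f ^^ k) x) y < 1 / real (Suc 0)"
      using assms[of 1 0] by auto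
    show "\<exists>k'. dist ((f ^^ k') x) y < 1 / real (Suc (Suc n)) \<and> k < k'" for k n
      using assms[of "1 / real (Suc (Suc n))" "Suc k"] by (metis Suc_le_lessD of_nat_0_less_iff zero_less_Suc zero_less_divide_1_iff)
  qed
  then obtain k where k: "\<And>n. dist ((f ^^ k n) x) y < 1 / real (Suc n)" "\<And>n. k n < k (Suc n)"
    by blast
  have "(\<lambda>n. (f ^^ k n) x) \<longlonglongrightarrow> y"
  proof (rule metric_tendsto_imp_tendsto)
    show "(\<lambda>n. 1 / real (Suc n)) \<longlonglongrightarrow> 0"
      by real_asymp
    show "\<forall>\<^sub>F n in sequentially. dist ((f ^^ k n) x) y \<le> dist (1 / real (Suc n)) 0"
      using k(1) by (intro always_eventually allI) (simp add: less_imp_le)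
  qed
  then show ?thesis
    using k(2) by (auto simp: omega_limit_def strict_mono_Suc_iff)
qed

lemma omega_limitD:
  fixes f :: "'a::metric_space \<Rightarrow> 'a"
  assumes "y \<in> omega_limit f x" "e > 0"
  shows "\<exists>n. dist ((f ^^ n) x) y < e"
proof -
  obtain k where "(\<lambda>i. (f ^^ k i) x) \<longlonglongrightarrow> y"
    using assms(1) by (auto simp: omega_limit_def)
  then have "\<forall>\<^sub>F i in sequentially. dist ((f ^^ k i) x) y < e"
    using assms(2) by (rule tendstoD)
  then show ?thesis
    using eventually_happens'[OF sequentially_bot] by blast
qed

lemma uncountable_bool_sequences: "uncountable (UNIV :: (nat \<Rightarrow> bool) set)"
proof
  assume "countable (UNIV :: (nat \<Rightarrow> bool) set)"
  then have "range (from_nat_into (UNIV :: (nat \<Rightarrow> bool) set)) = UNIV"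
    by (simp add: range_from_nat_into)
  \<comment> \<open>Cantor's diagonal sequence, set against the supposed enumeration.\<close>
  then obtain m where "(\<lambda>n. \<not> from_nat_into (UNIV :: (nat \<Rightarrow> bool) set) n n) = from_nat_into UNIV m"
    by (metis UNIV_I rangeE)
  then show False
    by (metis (mono_tags, lifting))
qed

section \<open>Orbits of coded points\<close>

context cut_scheme_language begin

lemma iterate_pt:
  assumes "s \<in> shift_space L"
  shows "(\<lambda>i. s (n + i)) \<in> shift_space L" "(f ^^ n) (pt s) = pt (\<lambda>i. s (n + i))"
proof -
  have tail: "s' \<circ> Suc \<in> shift_space L" if "s' \<in> shift_space L" for s'
    unfolding shift_space_def
  proof (intro CollectI allI)
    fix n
    have "pref s' (Suc n) \<in> L"
      using that by (simp add: shift_space_def)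
    then show "pref (s' \<circ> Suc) n \<in> L"
      using tl_L tl_pref by metis
  qed
  have "(\<lambda>i. s (n + i)) \<in> shift_space L \<and> (f ^^ n) (pt s) = pt (\<lambda>i. s (n + i))"
  proof (induction n)
    case (Suc n)
    then show ?case
      using tail[of "\<lambda>i. s (n + i)"] f_pt[of "\<lambda>i. s (n + i)"] by (simp add: o_def)
  qed (use assms in simp)
  then show "(\<lambda>i. s (n + i)) \<in> shift_space L" "(f ^^ n) (pt s) = pt (\<lambda>i. s (n + i))"
    by blast+
qed

lemma inj_pt: "inj pt"
proof (rule injI, rule ext)
  fix s s' n assume eq: "pt s = pt s'"
  obtain e where e: "e > 0" "\<And>s''. dist (pt s'') (pt s') < e \<Longrightarrow> pref s'' (Suc n) = pref s' (Suc n)"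
    using pt_near_imp_pref_eq[of s' "Suc n"] by metis
  have "pref s (Suc n) = pref s' (Suc n)"
    by (rule e(2)) (simp add: eq e(1))
  then show "s n = s' n"
    by (simp add: pref_eq_iff)
qed

lemma pt_in_omega_limit:
  assumes "s \<in> shift_space L" "\<And>n. \<exists>k\<ge>n. \<forall>i<n. s (k + i) = z i"
  shows "pt z \<in> omega_limit f (pt s)"
proof (rule omega_limitI)
  fix e :: real and N assume "e > 0"
  then obtain m where m: "(1/2::real)^m < e"
    using real_arch_pow_inv[of e "1/2"] by auto
  \<comment> \<open>\<open>N\<close> makes the time late, \<open>m\<close> the points close, and 1
    gives the nonempty prefix that \<open>dist_pt\<close> demands.\<close>
  define n where "n = N + m + 1"
  obtain k where k: "k \<ge> n" "\<forall>i<n. s (k + i) = z i"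
    using assms(2) by blast
  have "dist (pt (\<lambda>i. s (k + i))) (pt z) \<le> (1/2)^n"
    using k(2) by (intro dist_pt) (auto simp: pref_eq_iff n_def)
  also have "\<dots> \<le> (1/2)^m"
    by (intro power_decreasing) (auto simp: n_def)
  finally show "\<exists>n\<ge>N. dist ((f ^^ n) (pt s)) (pt z) < e"
    using m k(1) iterate_pt(2)[OF assms(1), of k] by (intro exI[of _ k]) (auto simp: n_def)
qed

lemma omega_limit_pt_imp:
  assumes "s \<in> shift_space L" "pt z \<in> omega_limit f (pt s)"
  shows "\<exists>k. \<forall>i<n. s (k + i) = z i"
proof -
  obtain e where e: "e > 0" "\<And>s'. dist (pt s') (pt z) < e \<Longrightarrow> pref s' n = pref z n"
    using pt_near_imp_pref_eq[of z n] by metis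
  obtain k where "dist ((f ^^ k) (pt s)) (pt z) < e"
    using omega_limitD[OF assms(2) e(1)] by blast
  then have "pref (\<lambda>i. s (k + i)) n = pref z n"
    unfolding iterate_pt(2)[OF assms(1)] by (rule e(2))
  then show ?thesis
    by (auto simp: pref_eq_iff)
qed

end

text \<open>A one can only spoil the at most \<open>m\<close> windows of length \<open>m\<close>
  that cover its position.\<close>

lemma card_nonzero_windows_le:
  fixes s :: "nat \<Rightarrow> bool"
  shows "card {i. i < n \<and> (\<exists>k<m. s (i + k))} \<le> m * card {i. i < n + m \<and> s i}"
proof -
  have "card {i. i < n \<and> s (i + k)} \<le> card {i. i < n + m \<and> s i}" if "k < m" for k
    using that by (intro card_inj_on_le[of "\<lambda>i. i + k"]) (auto simp: inj_on_def)
  then have "(\<Sum>k<m. card {i. i < n \<and> s (i + k)}) \<le> (\<Sum>k<m. card {i. i < n + m \<and> s i})"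
    by (intro sum_mono) auto
  moreover have "card (\<Union>k<m. {i. i < n \<and> s (i + k)}) \<le> (\<Sum>k<m. card {i. i < n \<and> s (i + k)})"
    by (rule card_UN_le) auto
  moreover have "{i. i < n \<and> (\<exists>k<m. s (i + k))} = (\<Union>k<m. {i. i < n \<and> s (i + k)})"
    by auto
  ultimately show ?thesis
    by simp
qed

lemma density_nonzero_windows:
  assumes "s \<in> shift_space lang"
  shows "(\<lambda>n. real (card {i. i < n \<and> (\<exists>k<m. s (i + k))}) / real n) \<longlonglongrightarrow> 0"
proof -
  have le: "real (card {i. i < n \<and> (\<exists>k<m. s (i + k))}) / real n \<le> real m * (1 + sqrt (4 * (real n + real m))) / real n" for n
  proof (intro divide_right_mono)
    define C where "C = card {i. i < n + m \<and> s i}"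
    have "real ((C - 1)\<^sup>2) \<le> real (4 * (n + m))"
      using card_ones[OF assms, of "n + m"] unfolding C_def of_nat_le_iff .
    then have "real (C - 1) \<le> sqrt (4 * (real n + real m))"
      by (intro real_le_rsqrt) simp
    then have "real C \<le> 1 + sqrt (4 * (real n + real m))"
      by linarith
    then have "real m * real C \<le> real m * (1 + sqrt (4 * (real n + real m)))"
      by (intro mult_left_mono) auto
    moreover have "real (card {i. i < n \<and> (\<exists>k<m. s (i + k))}) \<le> real m * real C"
      using card_nonzero_windows_le[of n m s] unfolding C_def of_nat_mult[symmetric] of_nat_le_iff .
    ultimately show "real (card {i. i < n \<and> (\<exists>k<m. s (i + k))}) \<le> real m * (1 + sqrt (4 * (real n + real m)))"
      by linarith
  qed auto
  have lim: "(\<lambda>n. real m * (1 + sqrt (4 * (real n + real m))) / real n) \<longlonglongrightarrow> 0"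
    by real_asymp
  show ?thesis
    by (rule tendsto_sandwich[OF _ always_eventually[OF allI[OF le]] tendsto_const lim]) simp
qed

section \<open>Attraction and the scrambled set\<close>

locale cut_scheme_ruler = cut_scheme_language G V c lang for G :: "'a::metric_space set" and V c
begin

text \<open>Unless a one occurs among the next \<open>m + 1\<close> letters, the orbit point shares
  a prefix of that length with the zero point; by \<open>density_nonzero_windows\<close> the
  exceptional times have density zero.\<close>

lemma pt_attracted:
  assumes s: "s \<in> shift_space lang"
  shows "attracted f (pt s) (pt (\<lambda>_. False))"
  unfolding attracted_def
proof (intro allI impI)
  fix t :: real assume "t > 0"
  then obtain m where m: "(1/2::real)^m < t"
    using real_arch_pow_inv[of t "1/2"] by auto
  have "{i. i < n \<and> t \<le> dist ((f ^^ i) (pt s)) (pt (\<lambda>_. False))} \<subseteq> {i. i < n \<and> (\<exists>k<Suc m. s (i + k))}" for n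
  proof
    fix i assume i: "i \<in> {i. i < n \<and> t \<le> dist ((f ^^ i) (pt s)) (pt (\<lambda>_. False))}"
    have "\<exists>k<Suc m. s (i + k)"
    proof (rule ccontr)
      assume "\<not> ?thesis"
      then have "dist (pt (\<lambda>k. s (i + k))) (pt (\<lambda>_. False)) \<le> (1/2) ^ Suc m"
        by (intro dist_pt) (auto simp: pref_eq_iff)
      also have "\<dots> \<le> (1/2)^m"
        by simp
      finally show False
        using i m iterate_pt(2)[OF s, of i] by simp
    qed
    then show "i \<in> {i. i < n \<and> (\<exists>k<Suc m. s (i + k))}"
      using i by simp
  qed
  then have "card {i. i < n \<and> t \<le> dist ((f ^^ i) (pt s)) (pt (\<lambda>_. False))} \<le> card {i. i < n \<and> (\<exists>k<Suc m. s (i + k))}" for n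
    by (intro card_mono) auto
  then have le: "real (card {i. i < n \<and> t \<le> dist ((f ^^ i) (pt s)) (pt (\<lambda>_. False))}) / real n \<le>
      real (card {i. i < n \<and> (\<exists>k<Suc m. s (i + k))}) / real n" for n
    by (intro divide_right_mono) auto
  show "(\<lambda>n. real (card {i. i < n \<and> t \<le> dist ((f ^^ i) (pt s)) (pt (\<lambda>_. False))}) / real n) \<longlonglongrightarrow> 0"
    by (rule tendsto_sandwich[OF _ always_eventually[OF allI[OF le]] tendsto_const density_nonzero_windows[OF s]]) simp
qed

lemma ex_attracted:
  assumes "y \<in> G"
  shows "\<exists>p. attracted f y p"
proof (cases rule: G_cases[OF assms])
  case (1 n)
  have "f (c []) = c []"
    using f_D[of "c []" 0] c_Nil_in_D[of 1] by simp
  then show ?thesis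
    using eventually_fixed_imp_attracted[OF iterate_f_D[OF 1]] by blast
next
  case (2 s)
  then show ?thesis
    using pt_attracted by blast
qed

lemma no_DC3_pair: "\<lbrakk>x \<in> G; y \<in> G\<rbrakk> \<Longrightarrow> \<not> DC3_pair G f x y"
  by (meson ex_attracted attracted_imp_not_DC3_pair)

lemma pt_ruler_limit_in_omega_limit: "pt (ruler_limit \<alpha> b) \<in> omega_limit f (pt (ruler \<alpha>))"
  by (rule pt_in_omega_limit[OF ruler_in_shift_space ruler_limit_occurs])

lemma pt_ruler_limit_notin_omega_limit:
  "\<alpha> \<noteq> \<beta> \<Longrightarrow> pt (ruler_limit \<alpha> b) \<notin> omega_limit f (pt (ruler \<beta>))"
  using ruler_limit_separates[OF omega_limit_pt_imp[OF ruler_in_shift_space]] by blast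

lemma pt_zero_in_omega_limit: "pt (\<lambda>_. False) \<in> omega_limit f (pt (ruler \<alpha>))"
  by (rule pt_in_omega_limit[OF ruler_in_shift_space]) (use zero_in_ruler_limit in simp)

text \<open>The sequence starts with a one, so periodicity would produce ones with positive
  frequency.\<close>

lemma pt_ruler_limit_not_periodic: "pt (ruler_limit \<alpha> b) \<notin> periodic_points G f"
proof
  assume "pt (ruler_limit \<alpha> b) \<in> periodic_points G f"
  then obtain n where n: "n > 0" "(f ^^ n) (pt (ruler_limit \<alpha> b)) = pt (ruler_limit \<alpha> b)"
    by (auto simp: periodic_points_def)
  then have "(\<lambda>i. ruler_limit \<alpha> b (n + i)) = ruler_limit \<alpha> b"
    using iterate_pt(2)[OF ruler_limit_in_shift_space] inj_pt by (metis injD)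
  then have "ruler_limit \<alpha> b (i + n) = ruler_limit \<alpha> b i" for i
    by (metis add.commute)
  then show False
    using not_periodic[OF ruler_limit_in_shift_space ruler_limit_0 n(1)] by blast
qed

text \<open>Read off from the omega-limit sets: one of them contains a point that the other
  misses.\<close>

lemma inj_pt_ruler: "inj (\<lambda>\<alpha>. pt (ruler \<alpha>))"
proof (rule injI, rule ccontr)
  fix \<alpha> \<beta> assume "pt (ruler \<alpha>) = pt (ruler \<beta>)" "\<alpha> \<noteq> \<beta>"
  then show False
    using pt_ruler_limit_in_omega_limit[of \<alpha>] pt_ruler_limit_notin_omega_limit[of \<alpha> \<beta>] by simp
qed

text \<open>The whole injective family \<open>pt (ruler_limit \<alpha> b)\<close>, over all digit
  sequences \<open>b\<close>, lies in the difference.\<close>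

lemma uncountable_omega_limit_diff:
  assumes "\<alpha> \<noteq> \<beta>"
  shows "uncountable (omega_limit f (pt (ruler \<alpha>)) - omega_limit f (pt (ruler \<beta>)))"
proof
  assume "countable (omega_limit f (pt (ruler \<alpha>)) - omega_limit f (pt (ruler \<beta>)))"
  moreover have "range (\<lambda>b. pt (ruler_limit \<alpha> b)) \<subseteq> omega_limit f (pt (ruler \<alpha>)) - omega_limit f (pt (ruler \<beta>))"
    using pt_ruler_limit_in_omega_limit pt_ruler_limit_notin_omega_limit[OF assms] by auto
  ultimately have "countable (range (\<lambda>b. pt (ruler_limit \<alpha> b)))"
    using countable_subset by blast
  moreover have "inj (\<lambda>b. pt (ruler_limit \<alpha> b))"
    using inj_compose[OF inj_pt inj_ruler_limit] by (simp add: o_def)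
  ultimately show False
    using countable_image_inj_eq uncountable_bool_sequences by blast
qed

lemma omega_scrambled_range: "omega_scrambled G f (range (\<lambda>\<alpha>. pt (ruler \<alpha>)))"
  unfolding omega_scrambled_def
proof (intro conjI ballI impI)
  have "pt (ruler (\<lambda>_. True)) \<noteq> pt (ruler (\<lambda>_. False))"
    using injD[OF inj_pt_ruler, of "\<lambda>_. True" "\<lambda>_. False"] by (auto dest: fun_cong)
  then show "\<exists>x\<in>range (\<lambda>\<alpha>. pt (ruler \<alpha>)). \<exists>y\<in>range (\<lambda>\<alpha>. pt (ruler \<alpha>)). x \<noteq> y"
    by blast
  fix x y assume "x \<in> range (\<lambda>\<alpha>. pt (ruler \<alpha>))" "y \<in> range (\<lambda>\<alpha>. pt (ruler \<alpha>))" "x \<noteq> y"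
  then obtain \<alpha> \<beta> where xy: "x = pt (ruler \<alpha>)" "y = pt (ruler \<beta>)" "\<alpha> \<noteq> \<beta>"
    by blast
  show "uncountable (omega_limit f x - omega_limit f y)"
    unfolding xy(1,2) by (rule uncountable_omega_limit_diff[OF xy(3)])
  show "omega_limit f x \<inter> omega_limit f y \<noteq> {}"
    using pt_zero_in_omega_limit xy by blast
  show "\<not> omega_limit f x \<subseteq> periodic_points G f"
    using pt_ruler_limit_in_omega_limit pt_ruler_limit_not_periodic xy(1) by blast
next
  show "range (\<lambda>\<alpha>. pt (ruler \<alpha>)) \<subseteq> G"
    using pt_in_G by blast
qed

end

theorem corollary5p5:
  fixes G :: "'a::metric_space set"
  assumes "gehman_dendrite G"
  shows "\<exists>f :: 'a \<Rightarrow> 'a. continuous_on G f \<and> f ` G \<subseteq> G \<and>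
           (\<forall>x\<in>G. \<forall>y\<in>G. \<not> DC3_pair G f x y) \<and>
           (\<exists>S. uncountable S \<and> omega_scrambled G f S)"
proof -
  have G: "compact G" "connected G" "locally connected G" "end_points G homeomorphic cantor_set"
    using assms unfolding gehman_dendrite_def dendrite_def continuum_def by blast+
  have E: "end_points G \<subseteq> G" "\<And>e. e \<in> end_points G \<Longrightarrow> order_at_most G e 1"
    unfolding end_points_def has_order_def by blast+
  obtain V c where "cut_scheme G V c"
    by (rule ex_cut_scheme[OF G(1-3) homeomorphic_cantor_set_perfect(1)[OF G(4)] E
        homeomorphic_cantor_set_perfect(2)[OF G(4)]])
  then interpret cut_scheme_ruler G V c
    by (intro cut_scheme_ruler.intro cut_scheme_language.intro cut_scheme_language_axioms.intro
        Nil_lang tl_lang butlast_lang)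
  have "uncountable (range (\<lambda>\<alpha>. pt (ruler \<alpha>)))"
    using countable_image_inj_eq[OF inj_pt_ruler] uncountable_bool_sequences by blast
  moreover have "f ` G \<subseteq> G"
    using F_tendsto(2) by blast
  ultimately show ?thesis
    using continuous_f no_DC3_pair omega_scrambled_range by metis
qed

end
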